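(* Let $G$ be an $r$-regular graph of order $n$ with $K_{s,s}$ as a star complement for an eigenvalue $\mu\notin\{-1,0\}$ of multiplicity $k$. Then $k\leq s(r-s)$, equivalently $n\leq s(r-s+2)$, with equality if and only if $\mu=1$ and $G\cong G_1$, $G_2$ or $G_3$. Here, for $S\subseteq\{1,2,3\}^2$, $\Gamma(S)$ is the graph with vertices $v_1,v_2,v_3,w_1,w_2,w_3$ and $u_{ij}$ for $(i,j)\in S$, with $v_i\sim w_j$ for all $i,j$, $u_{ij}\sim v_i$, $u_{ij}\sim w_j$, and $u_{ij}\sim u_{kl}$ iff $i\neq k$ and $j\neq l$ (no other edges); $G_1=\Gamma(\{(1,1),(2,2),(3,3)\})$, $G_2=\Gamma(\{(i,j):i\neq j\})$, $G_3=\Gamma(\{1,2,3\}^2)$.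
   Context: All graphs are finite and simple; eigenvalues are eigenvalues of the adjacency matrix. If $\mu$ is an eigenvalue of $G$ with multiplicity $k\ge1$, a star set for $\mu$ is $X\subseteq V(G)$ with $|X|=k$ such that $\mu$ is not an eigenvalue of the induced subgraph $G-X$; $H=G-X$ is a star complement for $\mu$. "$G$ has $K_{s,s}$ as a star complement for $\mu$" means some star set $X$ for $\mu$ satisfies $G-X\cong K_{s,s}$.
   Formalization: The equality characterization is stated for s ≥ 2 only (the bounds hold for all s): for s = 1 it fails for G = K_3 with μ = 2, k = 1, r = 2, which has K_{1,1} as a star complement and attains k = s(r−s) although μ ≠ 1; this is the only case with s = 1. *)

theory Defs
  imports
    "Graph_Theory.Graph_Theory"
    "Jordan_Normal_Form.Matrix_Kernel"
    "Jordan_Normal_Form.Char_Poly"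
begin

text \<open>
  A finite simple graph is a \<open>graph\<close> of the Graph Theory entry: a finite, symmetric, loopfree
  digraph without parallel arcs. Each edge is represented by its two opposite arcs, so that the
  out-degree of a vertex is its degree.
\<close>

definition regular_graph :: "('a, 'b) pre_digraph \<Rightarrow> nat \<Rightarrow> bool" where
  "regular_graph G r \<longleftrightarrow> (\<forall>v\<in>verts G. out_degree G v = r)"

text \<open>
  Matrices are indexed by natural numbers, so the adjacency matrix depends on an enumeration of the
  vertices. Different enumerations give permutation-similar matrices, so eigenvalues and their
  multiplicities do not depend on the enumeration chosen here.
\<close>

definition vertex_enum :: "('a, 'b) pre_digraph \<Rightarrow> 'a list" where
  "vertex_enum G = (SOME vs. distinct vs \<and> set vs = verts G)"

definition adjacency_matrix :: "('a, 'b) pre_digraph \<Rightarrow> real mat" where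
  "adjacency_matrix G =
     mat (card (verts G)) (card (verts G))
       (\<lambda>(i, j). if (vertex_enum G ! i, vertex_enum G ! j) \<in> arcs_ends G then 1 else 0)"

definition graph_eigenvalue :: "('a, 'b) pre_digraph \<Rightarrow> real \<Rightarrow> bool" where
  "graph_eigenvalue G \<mu> \<longleftrightarrow> eigenvalue (adjacency_matrix G) \<mu>"

text \<open>
  The multiplicity of an eigenvalue is the dimension of its eigenspace, the kernel of
  \<open>A - \<mu> I\<close>; as \<open>A\<close> is real symmetric, it is also the multiplicity of the root \<open>\<mu>\<close> of the
  characteristic polynomial.
\<close>

definition eigenvalue_multiplicity :: "('a, 'b) pre_digraph \<Rightarrow> real \<Rightarrow> nat" where
  "eigenvalue_multiplicity G \<mu> = kernel_dim (char_matrix (adjacency_matrix G) \<mu>)"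

definition star_set :: "('a, 'b) pre_digraph \<Rightarrow> real \<Rightarrow> 'a set \<Rightarrow> bool" where
  "star_set G \<mu> X \<longleftrightarrow>
     graph_eigenvalue G \<mu> \<and> X \<subseteq> verts G \<and> card X = eigenvalue_multiplicity G \<mu> \<and>
     \<not> graph_eigenvalue (induce_subgraph G (verts G - X)) \<mu>"

text \<open>
  The complete bipartite graph is given by the library as a predicate that holds of exactly the
  graphs isomorphic to it. The case \<open>s = 1\<close> is not excluded: the triangle is 2-regular and has
  the single edge \<open>K\<^bsub>1,1\<^esub>\<close> as a star complement for the simple eigenvalue 2. It attains
  the bound \<open>k = s (r - s)\<close>, and is the reason why a characterization of equality needs \<open>s \<ge> 2\<close>.
\<close>

definition has_Kss_star_complement :: "('a, 'b) pre_digraph \<Rightarrow> nat \<Rightarrow> real \<Rightarrow> bool" where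
  "has_Kss_star_complement G s \<mu> \<longleftrightarrow>
     (\<exists>X. star_set G \<mu> X \<and>
       complete_bipartite_digraph s s (induce_subgraph G (verts G - X)))"

datatype gamma_vertex = V_vert nat | W_vert nat | U_vert nat nat

text \<open>Each unordered edge of \<open>\<Gamma>(S)\<close> is listed in at least one direction by \<open>gamma_edges\<close>.\<close>

definition gamma_edges :: "(nat \<times> nat) set \<Rightarrow> gamma_vertex rel" where
  "gamma_edges S =
     {(V_vert i, W_vert j) | i j. i \<in> {1..3} \<and> j \<in> {1..3}} \<union>
     {(U_vert i j, V_vert i) | i j. (i, j) \<in> S} \<union>
     {(U_vert i j, W_vert j) | i j. (i, j) \<in> S} \<union>
     {(U_vert i j, U_vert k l) | i j k l. (i, j) \<in> S \<and> (k, l) \<in> S \<and> i \<noteq> k \<and> j \<noteq> l}"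

definition Gamma_graph :: "(nat \<times> nat) set \<Rightarrow> (gamma_vertex, gamma_vertex \<times> gamma_vertex) pre_digraph" where
  "Gamma_graph S =
     with_proj \<lparr>pverts = V_vert ` {1..3} \<union> W_vert ` {1..3} \<union> {U_vert i j | i j. (i, j) \<in> S},
      parcs = gamma_edges S \<union> (gamma_edges S)\<inverse>\<rparr>"

definition G1 :: "(gamma_vertex, gamma_vertex \<times> gamma_vertex) pre_digraph" where
  "G1 = Gamma_graph {(1, 1), (2, 2), (3, 3)}"

definition G2 :: "(gamma_vertex, gamma_vertex \<times> gamma_vertex) pre_digraph" where
  "G2 = Gamma_graph {(i, j). i \<in> {1..3} \<and> j \<in> {1..3} \<and> i \<noteq> j}"

definition G3 :: "(gamma_vertex, gamma_vertex \<times> gamma_vertex) pre_digraph" where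
  "G3 = Gamma_graph ({1..3} \<times> {1..3})"

end

theory Submission
  imports Defs
begin

text \<open>
  If \<open>X\<close> is a star set, restriction to \<open>X\<close> is an isomorphism from the eigenspace of \<open>\<mu>\<close> to the
  functions on \<open>X\<close>: it is injective because \<open>\<mu>\<close> is not an eigenvalue of \<open>G - X\<close>, and the dimensions
  agree. Extending the indicator of \<open>u \<in> X\<close> to an eigenfunction and evaluating the eigenvalue equation
  at \<open>v \<in> X\<close> gives an identity in the numbers \<open>a\<close>, \<open>b\<close> of neighbours of \<open>u\<close> and \<open>v\<close> in the two parts
  of \<open>K\<^bsub>s,s\<^esub>\<close> and the number of their common neighbours there. If \<open>\<mu> \<noteq> r\<close>, orthogonality to the
  constant functions gives \<open>a + b = s - \<mu>\<close> as well, so \<open>\<mu>\<close> is an integer in any case. The identity for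
  \<open>u = v\<close> then excludes \<open>a + b \<le> 1\<close>, and counting the edges between \<open>X\<close> and \<open>K\<^bsub>s,s\<^esub>\<close> gives
  \<open>2 k \<le> 2 s (r - s)\<close>.

  In case of equality \<open>a + b = 2\<close> throughout, and for \<open>s \<ge> 2\<close> the diagonal identity forces \<open>s = 3\<close>,
  \<open>\<mu> = 1\<close> and \<open>a = b = 1\<close>. The identity for \<open>u \<noteq> v\<close> now says that distinct vertices of \<open>X\<close> have
  distinct pairs of neighbours in \<open>K\<^bsub>3,3\<^esub>\<close> and are adjacent iff these pairs are disjoint. So
  \<open>G \<cong> \<Gamma>(S)\<close>, where \<open>S\<close> has \<open>r - 3\<close> elements in each row and column: it is a permutation matrix,
  the complement of one, or everything.
\<close>

section \<open>Eigenfunctions of graphs\<close>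

text \<open>Restricting a kernel basis to the positions in \<open>I\<close> gives a square matrix,
  because \<open>card I\<close> is the kernel dimension. The hypothesis \<open>zero\<close> makes it
  injective, hence invertible.\<close>

lemma kernel_vector_prescribed:
  fixes A :: "'a :: field mat"
  assumes A: "A \<in> carrier_mat nr nc"
    and I: "I \<subseteq> {..<nc}" "card I = kernel_dim A"
    and zero: "\<And>v. v \<in> mat_kernel A \<Longrightarrow> (\<forall>i\<in>I. v $ i = 0) \<Longrightarrow> v = 0\<^sub>v nc"
  shows "\<exists>v\<in>mat_kernel A. \<forall>i\<in>I. v $ i = f i"
proof -
  interpret kernel nr nc A by unfold_locales (rule A)
  define m where "m = kernel_dim A"
  obtain B where B: "finite B" "basis B" using kernel_basis_exists[OF A] by blast
  have BK: "B \<subseteq> mat_kernel A" and indep: "lin_indpt B"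
    using B(2) unfolding Ker.basis_def by auto
  have "card B = m" using Ker.dim_basis[OF B] by (simp add: m_def)
  then obtain b where b: "bij_betw b {..<m} B"
    using ex_bij_betw_nat_finite[OF B(1)] by (auto simp: atLeast0LessThan)
  have "finite I" using I(1) finite_subset by blast
  then obtain e where e: "bij_betw e {..<m} I"
    using ex_bij_betw_nat_finite[of I] I(2) by (auto simp: atLeast0LessThan m_def)
  \<comment> \<open>Columns are basis vectors, rows the positions in \<open>I\<close>:
    \<open>M *\<^sub>v w\<close> lists the values on \<open>I\<close> of the combination with
    coefficients \<open>w\<close>.\<close>
  define M where "M = mat m m (\<lambda>(i, j). b j $ e i)"
  have M: "M \<in> carrier_mat m m" by (simp add: M_def)
  have comb: "\<exists>c. lincomb c B \<in> mat_kernel A \<and> (\<forall>i<m. lincomb c B $ e i = (M *\<^sub>v w) $ i) \<and>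
      (\<forall>j<m. c (b j) = w $ j)" if w: "w \<in> carrier_vec m" for w
  proof -
    define c where "c = (\<lambda>x. w $ the_inv_into {..<m} b x)"
    have c: "c (b j) = w $ j" if "j < m" for j
      using that b by (simp add: c_def the_inv_into_f_f bij_betw_def)
    have "lincomb c B $ e i = (M *\<^sub>v w) $ i" if i: "i < m" for i
    proof -
      have "e i < nc" using e i I(1) by (auto simp: bij_betw_def)
      then have "lincomb c B $ e i = (\<Sum>x\<in>B. c x * x $ e i)"
        by (rule lincomb_index[OF _ BK])
      also have "\<dots> = (\<Sum>j<m. c (b j) * b j $ e i)"
        by (rule sum.reindex_bij_betw[OF b, symmetric])
      also have "\<dots> = (\<Sum>j<m. M $$ (i, j) * w $ j)"
        by (rule sum.cong) (auto simp: c M_def i)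
      also have "\<dots> = (M *\<^sub>v w) $ i"
        using i w by (simp add: M_def scalar_prod_def atLeast0LessThan)
      finally show ?thesis .
    qed
    moreover have "lincomb c B \<in> mat_kernel A"
      using Ker.lincomb_closed[OF BK] by auto
    ultimately show ?thesis using c by blast
  qed
  \<comment> \<open>A vector \<open>w\<close> killed by \<open>M\<close> gives a combination
    vanishing on \<open>I\<close>, hence zero; independence of \<open>B\<close> then forces
    \<open>w\<close> to be zero.\<close>
  have "det M \<noteq> 0"
  proof
    assume "det M = 0"
    then obtain w where w: "w \<in> carrier_vec m" "w \<noteq> 0\<^sub>v m" "M *\<^sub>v w = 0\<^sub>v m"
      using det_0_iff_vec_prod_zero_field[OF M] by blast
    from comb[OF w(1)] obtain c where c: "lincomb c B \<in> mat_kernel A"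
      "\<forall>i<m. lincomb c B $ e i = (M *\<^sub>v w) $ i" "\<forall>j<m. c (b j) = w $ j" by blast
    have "\<forall>i\<in>I. lincomb c B $ i = 0"
      using c(2) w(3) e by (auto simp: bij_betw_def)
    then have "lincomb c B = 0\<^sub>v nc" using zero c(1) by blast
    then have c0: "c x = 0" if "x \<in> B" for x
      using indep Ker.lin_dep_crit[OF B(1) subset_refl, of c x] that by auto
    have "w $ j = 0" if "j < m" for j
    proof -
      have "b j \<in> B" using b that by (auto simp: bij_betw_def)
      with c0 c(3) that show ?thesis by auto
    qed
    then have "w = 0\<^sub>v m" using w(1) by (intro eq_vecI) auto
    with w(2) show False by simp
  qed
  then obtain N where N: "N \<in> carrier_mat m m" "M * N = 1\<^sub>m m"
    using det_non_zero_imp_unit[OF M, of "()"] by (auto simp: Units_def ring_mat_def)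
  define g where "g = vec m (\<lambda>i. f (e i))"
  have g: "g \<in> carrier_vec m" by (simp add: g_def)
  have Mw: "M *\<^sub>v (N *\<^sub>v g) = g"
    using assoc_mult_mat_vec[OF M N(1) g] N(2) g by simp
  obtain c where c: "lincomb c B \<in> mat_kernel A" "\<forall>i<m. lincomb c B $ e i = (M *\<^sub>v (N *\<^sub>v g)) $ i"
    using comb[of "N *\<^sub>v g"] N g by fastforce
  have "\<forall>i\<in>I. lincomb c B $ i = f i"
    using c(2) e unfolding Mw by (auto simp: bij_betw_def g_def)
  with c(1) show ?thesis by blast
qed

section \<open>Eigenvectors as functions on the vertices\<close>

definition eigenfunction :: "('a, 'b) pre_digraph \<Rightarrow> real \<Rightarrow> ('a \<Rightarrow> real) \<Rightarrow> bool" where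
  "eigenfunction G \<mu> x \<longleftrightarrow> (\<forall>u\<in>verts G. (\<Sum>w | (u, w) \<in> arcs_ends G. x w) = \<mu> * x u)"

lemma vertex_enum:
  assumes "finite (verts G)"
  shows "bij_betw ((!) (vertex_enum G)) {..<card (verts G)} (verts G)"
proof -
  have "\<exists>vs. distinct vs \<and> set vs = verts G"
    using finite_distinct_list[OF assms] by blast
  then have vs: "distinct (vertex_enum G)" "set (vertex_enum G) = verts G"
    using someI_ex[of "\<lambda>vs. distinct vs \<and> set vs = verts G"] by (auto simp: vertex_enum_def)
  then show ?thesis
    using bij_betw_nth[of "vertex_enum G"] distinct_card[of "vertex_enum G"] by auto
qed

lemma ball_verts_iff_vertex_enum:
  assumes "finite (verts G)"
  shows "(\<forall>u\<in>verts G. P u) \<longleftrightarrow> (\<forall>i<card (verts G). P (vertex_enum G ! i))"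
  using bij_betw_imp_surj_on[OF vertex_enum[OF assms]] by (metis imageE imageI lessThan_iff)

definition vertex_vec :: "('a, 'b) pre_digraph \<Rightarrow> ('a \<Rightarrow> real) \<Rightarrow> real vec" where
  "vertex_vec G x = vec (card (verts G)) (\<lambda>i. x (vertex_enum G ! i))"

lemma vertex_vec_surj:
  assumes "finite (verts G)" "v \<in> carrier_vec (card (verts G))"
  shows "\<exists>x. v = vertex_vec G x"
proof (intro exI eq_vecI)
  let ?x = "\<lambda>u. v $ the_inv_into {..<card (verts G)} ((!) (vertex_enum G)) u"
  show "v $ i = vertex_vec G ?x $ i" if "i < dim_vec (vertex_vec G ?x)" for i
    using that vertex_enum[OF assms(1)]
    by (simp add: vertex_vec_def the_inv_into_f_f bij_betw_def)
qed (use assms in \<open>auto simp: vertex_vec_def\<close>)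

lemma vertex_vec_eq_0_iff:
  assumes "finite (verts G)"
  shows "vertex_vec G x = 0\<^sub>v (card (verts G)) \<longleftrightarrow> (\<forall>u\<in>verts G. x u = 0)"
  unfolding ball_verts_iff_vertex_enum[OF assms] by (auto simp: vertex_vec_def vec_eq_iff)

lemma vertex_vec_in_kernel_iff:
  assumes "fin_digraph G"
  shows "vertex_vec G x \<in> mat_kernel (char_matrix (adjacency_matrix G) \<mu>) \<longleftrightarrow> eigenfunction G \<mu> x"
proof -
  interpret fin_digraph G by fact
  let ?n = "card (verts G)" and ?A = "adjacency_matrix G" and ?e = "vertex_enum G"
  note bij = vertex_enum[OF finite_verts]
  have A: "?A \<in> carrier_mat ?n ?n" by (simp add: adjacency_matrix_def)
  have v: "vertex_vec G x \<in> carrier_vec ?n" by (simp add: vertex_vec_def)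
  have row: "(char_matrix ?A \<mu> *\<^sub>v vertex_vec G x) $ i =
      (\<Sum>w | (?e ! i, w) \<in> arcs_ends G. x w) - \<mu> * x (?e ! i)" if i: "i < ?n" for i
  proof -
    have "(char_matrix ?A \<mu> *\<^sub>v vertex_vec G x) $ i =
        (\<Sum>j<?n. ((if (?e ! i, ?e ! j) \<in> arcs_ends G then 1 else 0) - (if i = j then \<mu> else 0)) * x (?e ! j))"
      using i A by (auto simp: char_matrix_def adjacency_matrix_def vertex_vec_def scalar_prod_def
          atLeast0LessThan intro!: sum.cong)
    also have "\<dots> = (\<Sum>j<?n. if (?e ! i, ?e ! j) \<in> arcs_ends G then x (?e ! j) else 0)
        - (\<Sum>j<?n. if i = j then \<mu> * x (?e ! j) else 0)"
      unfolding sum_subtractf[symmetric] by (intro sum.cong) (auto simp: algebra_simps)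
    also have "(\<Sum>j<?n. if (?e ! i, ?e ! j) \<in> arcs_ends G then x (?e ! j) else 0)
        = (\<Sum>w\<in>verts G. if (?e ! i, w) \<in> arcs_ends G then x w else 0)"
      by (rule sum.reindex_bij_betw[OF bij])
    also have "\<dots> = (\<Sum>w | (?e ! i, w) \<in> arcs_ends G. x w)"
      using adj_in_verts by (intro sum.mono_neutral_cong_right) auto
    also have "(\<Sum>j<?n. if i = j then \<mu> * x (?e ! j) else 0) = \<mu> * x (?e ! i)"
      using i by simp
    finally show ?thesis .
  qed
  have "vertex_vec G x \<in> mat_kernel (char_matrix ?A \<mu>) \<longleftrightarrow>
      char_matrix ?A \<mu> *\<^sub>v vertex_vec G x = 0\<^sub>v ?n"
    using mat_kernel[OF char_matrix_closed[OF A]] v by auto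
  also have "\<dots> \<longleftrightarrow> (\<forall>i<?n. (char_matrix ?A \<mu> *\<^sub>v vertex_vec G x) $ i = 0)"
    using char_matrix_closed[OF A, of \<mu>] v by (auto simp: vec_eq_iff simp del: index_mult_mat_vec)
  also have "\<dots> \<longleftrightarrow> (\<forall>i<?n. (\<Sum>w | (?e ! i, w) \<in> arcs_ends G. x w) = \<mu> * x (?e ! i))"
    using row by (auto simp del: index_mult_mat_vec)
  also have "\<dots> \<longleftrightarrow> eigenfunction G \<mu> x"
    unfolding eigenfunction_def ball_verts_iff_vertex_enum[OF finite_verts] ..
  finally show ?thesis .
qed

lemma graph_eigenvalue_iff_eigenfunction:
  assumes "fin_digraph G"
  shows "graph_eigenvalue G \<mu> \<longleftrightarrow> (\<exists>x. eigenfunction G \<mu> x \<and> (\<exists>u\<in>verts G. x u \<noteq> 0))"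
proof -
  interpret fin_digraph G by fact
  let ?n = "card (verts G)" and ?A = "adjacency_matrix G"
  have A: "?A \<in> carrier_mat ?n ?n" by (simp add: adjacency_matrix_def)
  have "graph_eigenvalue G \<mu> \<longleftrightarrow>
      (\<exists>v \<in> mat_kernel (char_matrix ?A \<mu>). v \<in> carrier_vec ?n \<and> v \<noteq> 0\<^sub>v ?n)"
    using mat_kernel[OF char_matrix_closed[OF A]]
    by (auto simp: graph_eigenvalue_def eigenvalue_char_matrix[OF A])
  also have "\<dots> \<longleftrightarrow> (\<exists>x. vertex_vec G x \<in> mat_kernel (char_matrix ?A \<mu>) \<and> vertex_vec G x \<noteq> 0\<^sub>v ?n)"
    using vertex_vec_surj[OF finite_verts] by (fastforce simp: vertex_vec_def)
  finally show ?thesis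
    by (simp add: vertex_vec_in_kernel_iff[OF assms] vertex_vec_eq_0_iff)
qed

text \<open>Neighbours outside \<open>S\<close> contribute zero, so the sums at vertices of
  \<open>S\<close> do not change.\<close>

lemma eigenfunction_induce_subgraph:
  assumes "fin_digraph G" "eigenfunction G \<mu> x" "S \<subseteq> verts G" "\<forall>u\<in>verts G - S. x u = 0"
  shows "eigenfunction (induce_subgraph G S) \<mu> x"
  unfolding eigenfunction_def
proof
  interpret fin_digraph G by fact
  fix u assume u: "u \<in> verts (induce_subgraph G S)"
  have "{w. (u, w) \<in> arcs_ends G} \<subseteq> verts G" using adj_in_verts by auto
  then have fin: "finite {w. (u, w) \<in> arcs_ends G}" using finite_verts finite_subset by blast
  have ends: "arcs_ends (induce_subgraph G S) = arcs_ends G \<inter> S \<times> S"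
    by (auto simp: arcs_ends_conv)
  have "(\<Sum>w | (u, w) \<in> arcs_ends (induce_subgraph G S). x w) = (\<Sum>w | (u, w) \<in> arcs_ends G. x w)"
    using u assms(4) adj_in_verts fin unfolding ends by (intro sum.mono_neutral_left) auto
  then show "(\<Sum>w | (u, w) \<in> arcs_ends (induce_subgraph G S). x w) = \<mu> * x u"
    using assms(2,3) u by (auto simp: eigenfunction_def)
qed

text \<open>Apply \<open>kernel_vector_prescribed\<close> at the positions of \<open>X\<close>: an
  eigenfunction vanishing on \<open>X\<close> restricts to one of \<open>G - X\<close>, where only
  zero is possible.\<close>

lemma star_set_eigenfunction:
  assumes "fin_digraph G" "star_set G \<mu> X"
  shows "\<exists>x. eigenfunction G \<mu> x \<and> (\<forall>u\<in>X. x u = f u)"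
proof -
  interpret fin_digraph G by fact
  let ?n = "card (verts G)" and ?A = "adjacency_matrix G" and ?e = "vertex_enum G"
  let ?K = "char_matrix ?A \<mu>"
  have K: "?K \<in> carrier_mat ?n ?n" by (simp add: adjacency_matrix_def)
  note bij = vertex_enum[OF finite_verts]
  from assms(2) have X: "X \<subseteq> verts G" "card X = kernel_dim ?K"
    and noev: "\<not> graph_eigenvalue (induce_subgraph G (verts G - X)) \<mu>"
    by (auto simp: star_set_def eigenvalue_multiplicity_def)
  have H: "fin_digraph (induce_subgraph G (verts G - X))"
    by (auto intro: fin_digraph.intro simp: fin_digraph_axioms_def wellformed_induce_subgraph)
  define I where "I = {i. i < ?n \<and> ?e ! i \<in> X}"
  have I: "bij_betw ((!) ?e) I X"
    using bij X(1) by (auto simp: I_def bij_betw_def inj_on_def image_iff)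
  then have index: "\<exists>i\<in>I. i < ?n \<and> u = ?e ! i" if "u \<in> X" for u
    using that by (force simp: bij_betw_def I_def)
  have "\<exists>v\<in>mat_kernel ?K. \<forall>i\<in>I. v $ i = f (?e ! i)"
  proof (rule kernel_vector_prescribed[OF K])
    show "I \<subseteq> {..<?n}" by (auto simp: I_def)
    show "card I = kernel_dim ?K" using bij_betw_same_card[OF I] X(2) by simp
    fix v assume v: "v \<in> mat_kernel ?K" "\<forall>i\<in>I. v $ i = 0"
    then have "v \<in> carrier_vec ?n" using mat_kernelD(1)[OF K] by blast
    then obtain x where x: "v = vertex_vec G x" using vertex_vec_surj[OF finite_verts] by auto
    have ef: "eigenfunction G \<mu> x" using v(1) vertex_vec_in_kernel_iff[OF assms(1)] x by simp
    have x0: "x u = 0" if "u \<in> X" for u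
      using index[OF that] v(2) by (auto simp: x vertex_vec_def)
    have "eigenfunction (induce_subgraph G (verts G - X)) \<mu> x"
      using x0 X(1) by (intro eigenfunction_induce_subgraph[OF assms(1) ef]) auto
    then have "x u = 0" if "u \<in> verts G - X" for u
      using noev that graph_eigenvalue_iff_eigenfunction[OF H] by auto
    with x0 have "\<forall>u\<in>verts G. x u = 0" by blast
    then show "v = 0\<^sub>v ?n" unfolding x vertex_vec_eq_0_iff[OF finite_verts] .
  qed
  then obtain v where v: "v \<in> mat_kernel ?K" "\<forall>i\<in>I. v $ i = f (?e ! i)" by blast
  then have "v \<in> carrier_vec ?n" using mat_kernelD(1)[OF K] by blast
  then obtain x where x: "v = vertex_vec G x" using vertex_vec_surj[OF finite_verts] by auto
  have "eigenfunction G \<mu> x" using v(1) vertex_vec_in_kernel_iff[OF assms(1)] x by simp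
  moreover have "x u = f u" if "u \<in> X" for u
    using index[OF that] v(2) by (auto simp: x vertex_vec_def)
  ultimately show ?thesis by blast
qed

section \<open>Regular graphs with a complete bipartite star complement\<close>

text \<open>Serves to exclude vertices of \<open>X\<close> with a single neighbour in
  \<open>K_{s,s}\<close>. The alternatives for \<open>m\<close> come from \<mu> = s - 1 and from
  \<mu> = r.\<close>

lemma int_star_equation_1_impossible:
  fixes m s :: int
  assumes "0 < s" "m \<noteq> 0" "m\<^sup>2 \<noteq> s\<^sup>2" "m = s - 1 \<or> s \<le> m"
  shows "(m\<^sup>2 - 1) * (m\<^sup>2 - s\<^sup>2) \<noteq> s"
proof
  assume eq: "(m\<^sup>2 - 1) * (m\<^sup>2 - s\<^sup>2) = s"
  show False
  proof (cases "m = s - 1")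
    case True
    have "s * ((s - 2) * (1 - 2 * s)) = s * 1"
      using eq unfolding True by (simp add: power2_eq_square algebra_simps)
    then have "(s - 2) * (1 - 2 * s) = 1" using assms(1) by simp
    \<comment> \<open>Both factors are 1 or both are -1, which leaves s = 1 and m = 0.\<close>
    then show False using True assms by (auto simp: zmult_eq_1_iff)
  next
    case False
    \<comment> \<open>The squares exclude m = s. Beyond it, \<open>m\<^sup>2 - s\<^sup>2\<close>
      already exceeds \<open>s\<close>, and the other factor is at least 1.\<close>
    with assms have m: "s + 1 \<le> m" by (cases "m = s") auto
    have "m\<^sup>2 - s\<^sup>2 = (m - s) * (m + s)" by (simp add: power2_eq_square algebra_simps)
    moreover have "1 * (m + s) \<le> (m - s) * (m + s)" using m assms(1) by (intro mult_right_mono) auto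
    ultimately have "m + s \<le> m\<^sup>2 - s\<^sup>2" by (metis mult_1)
    then have D: "s < m\<^sup>2 - s\<^sup>2" using m assms(1) by linarith
    have "1 * (m\<^sup>2 - s\<^sup>2) \<le> (m\<^sup>2 - 1) * (m\<^sup>2 - s\<^sup>2)"
    proof (rule mult_right_mono)
      have "2\<^sup>2 \<le> m\<^sup>2" using m assms(1) by (intro power_mono) auto
      then show "1 \<le> m\<^sup>2 - 1" by simp
    qed (use D assms(1) in auto)
    then show False using D eq by simp
  qed
qed

text \<open>The alternative of large \<open>m\<close> fails by size, and m = s - 2 leaves a cubic in
  \<open>s\<close>. For s = 1 there would be the further solution m = 2, a = b = 1, coming from the
  triangle.\<close>

lemma int_star_equation_2:
  fixes m s :: int and a b :: nat
  assumes s: "2 \<le> s" and m: "m \<noteq> 0" "m\<^sup>2 \<noteq> s\<^sup>2" "m = s - 2 \<or> s \<le> m" and ab: "a + b = 2"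
    and eq: "m\<^sup>2 * (m\<^sup>2 - s\<^sup>2) = (m\<^sup>2 - s\<^sup>2) * 2 + 2 * m * a * b + s * ((int a)\<^sup>2 + (int b)\<^sup>2)"
  shows "s = 3 \<and> m = 1 \<and> a = 1 \<and> b = 1"
proof -
  consider "a = 0" "b = 2" | "a = 1" "b = 1" | "a = 2" "b = 0" using ab by linarith
  then have eqs: "(m\<^sup>2 - 2) * (m\<^sup>2 - s\<^sup>2) = 4 * s \<or>
      a = 1 \<and> b = 1 \<and> (m\<^sup>2 - 2) * (m\<^sup>2 - s\<^sup>2) = 2 * m + 2 * s"
    using eq by cases (auto simp: algebra_simps)
  have ms2: "m = s - 2"
  proof (rule ccontr)
    assume "m \<noteq> s - 2"
    with m have ms: "s + 1 \<le> m" by (cases "m = s") auto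
    have "m\<^sup>2 - s\<^sup>2 = (m - s) * (m + s)" by (simp add: power2_eq_square algebra_simps)
    moreover have "1 * (m + s) \<le> (m - s) * (m + s)" using ms s by (intro mult_right_mono) auto
    ultimately have D: "m + s \<le> m\<^sup>2 - s\<^sup>2" by (metis mult_1)
    \<comment> \<open>The first factor is at least 7, while both possible right-hand sides are below
      7 (m + s).\<close>
    have "3\<^sup>2 \<le> m\<^sup>2" using ms s by (intro power_mono) auto
    then have "7 * (m + s) \<le> (m\<^sup>2 - 2) * (m\<^sup>2 - s\<^sup>2)"
      using D ms s by (intro mult_mono) auto
    with ms s eqs show False by auto
  qed
  have "(m\<^sup>2 - 2) * (m\<^sup>2 - s\<^sup>2) = 4 * ((s\<^sup>2 - 4 * s + 2) * (1 - s))"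
    unfolding ms2 by (simp add: power2_eq_square algebra_simps)
  with eqs ms2 consider "m = s - 2" "(s\<^sup>2 - 4 * s + 2) * (1 - s) = s"
    | "m = s - 2" "a = 1" "b = 1" "(s\<^sup>2 - 4 * s + 2) * (1 - s) = s - 1" by (elim disjE) auto
  then show ?thesis
  proof cases
    case 1
    have "s * (5 * s - 7 - s\<^sup>2) = - 2"
      using 1(2) by (simp add: power2_eq_square algebra_simps)
    \<comment> \<open>This leaves s = 2, hence m = 0, which is excluded.\<close>
    then have "s dvd 2" by (metis dvd_minus_iff dvd_triv_left)
    then have "s = 2" using s zdvd_imp_le[of s 2] by simp
    then show ?thesis using 1 m by simp
  next
    case 2
    \<comment> \<open>The cubic is (s - 1)^2 (s - 3), so s = 3 remains.\<close>
    have "(s - 1) * (s\<^sup>2 - 4 * s + 3) = 0"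
      using 2(4) by (simp add: power2_eq_square algebra_simps)
    then have "s\<^sup>2 - 4 * s + 3 = 0" using s by simp
    then have "(s - 1) * (s - 3) = 0" by (simp add: power2_eq_square algebra_simps)
    then show ?thesis using s 2 by simp
  qed
qed

section \<open>A star complement with parts \<open>P\<close> and \<open>Q\<close>, and its
  eigenfunctions\<close>

locale Kss_star_complement = graph G for G :: "('a, 'b) pre_digraph" +
  fixes r s :: nat and \<mu> :: real and X P Q :: "'a set"
  assumes regular: "regular_graph G r"
    and star: "star_set G \<mu> X"
    and parts: "verts G - X = P \<union> Q" "P \<inter> Q = {}" "card P = s" "card Q = s"
    and bipartite: "arcs_ends (induce_subgraph G (verts G - X)) = P \<times> Q \<union> Q \<times> P"
    and \<mu>_nonzero: "\<mu> \<noteq> 0"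
begin

definition nbrs :: "'a \<Rightarrow> 'a set" where
  "nbrs u = {w. (u, w) \<in> arcs_ends G}"

definition degP :: "'a \<Rightarrow> nat" where
  "degP u = card (nbrs u \<inter> P)"

definition degQ :: "'a \<Rightarrow> nat" where
  "degQ u = card (nbrs u \<inter> Q)"

text \<open>Common neighbours in \<open>X\<close> are left out: this is the inner product of the
  neighbourhood indicators on the star complement.\<close>

definition codeg :: "'a \<Rightarrow> 'a \<Rightarrow> nat" where
  "codeg u v = card (nbrs u \<inter> nbrs v \<inter> (P \<union> Q))"

lemma X_subset: "X \<subseteq> verts G" and X_nonempty: "X \<noteq> {}"
proof -
  show "X \<subseteq> verts G" using star by (auto simp: star_set_def)
  show "X \<noteq> {}"
  proof
    assume "X = {}"
    moreover have "induce_subgraph G (verts G - {}) = G"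
      by (rule pre_digraph.equality) auto
    ultimately show False using star unfolding star_set_def by auto
  qed
qed

lemma finite_parts [simp]: "finite X" "finite P" "finite Q"
proof -
  show "finite X" using X_subset finite_verts finite_subset by blast
  have "finite (P \<union> Q)" unfolding parts(1)[symmetric] by simp
  then show "finite P" "finite Q" by auto
qed

lemma verts_eq: "verts G = X \<union> P \<union> Q" and disjoint: "X \<inter> P = {}" "X \<inter> Q = {}"
  using parts(1) X_subset by blast+

lemma card_verts: "card (verts G) = card X + 2 * s"
proof -
  have "verts G = X \<union> (P \<union> Q)" using verts_eq by blast
  moreover have "card (P \<union> Q) = 2 * s" using parts by (simp add: card_Un_disjoint)
  moreover have "X \<inter> (P \<union> Q) = {}" using disjoint by blast
  ultimately show ?thesis by (simp add: card_Un_disjoint)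
qed

lemma nbrs_subset: "nbrs u \<subseteq> verts G"
  by (auto simp: nbrs_def adj_in_verts)

lemma finite_nbrs [simp]: "finite (nbrs u)"
  using nbrs_subset finite_verts finite_subset by blast

lemma nbrs_sym: "w \<in> nbrs u \<longleftrightarrow> u \<in> nbrs w"
  using arcs_ends_symmetric[OF sym_arcs] by (auto simp: nbrs_def)

lemma nbrs_irrefl: "u \<notin> nbrs u"
  using adj_not_same by (auto simp: nbrs_def)

lemma card_nbrs: "u \<in> verts G \<Longrightarrow> card (nbrs u) = r"
proof -
  assume u: "u \<in> verts G"
  have "nbrs u = head G ` out_arcs G u"
    by (auto simp: nbrs_def arcs_ends_conv image_iff)
  moreover have "inj_on (head G) (out_arcs G u)"
    using no_multi_arcs by (auto simp: inj_on_def arc_to_ends_def)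
  ultimately show ?thesis
    using regular u by (simp add: card_image regular_graph_def out_degree_def)
qed

lemma ends_in_H: "u \<in> P \<union> Q \<Longrightarrow> v \<in> P \<union> Q \<Longrightarrow> v \<in> nbrs u \<longleftrightarrow> (u, v) \<in> P \<times> Q \<union> Q \<times> P"
proof -
  assume uv: "u \<in> P \<union> Q" "v \<in> P \<union> Q"
  have "(u, v) \<in> arcs_ends (induce_subgraph G (verts G - X)) \<longleftrightarrow> v \<in> nbrs u"
    using uv parts(1) by (auto simp: nbrs_def arcs_ends_conv)
  then show ?thesis using bipartite by simp
qed

lemma nbrs_P: "u \<in> P \<Longrightarrow> nbrs u = Q \<union> (nbrs u \<inter> X)"
  and nbrs_Q: "u \<in> Q \<Longrightarrow> nbrs u = P \<union> (nbrs u \<inter> X)"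
  using ends_in_H[of u] nbrs_subset[of u] verts_eq parts(2) by blast+

lemma nbrs_X: "nbrs u = (nbrs u \<inter> X) \<union> ((nbrs u \<inter> P) \<union> (nbrs u \<inter> Q))"
  using nbrs_subset[of u] verts_eq by blast

text \<open>For s = 0 the indicator of a vertex would be an eigenfunction. It sums to zero over the
  neighbours of that vertex, so \<mu> would be 0.\<close>

lemma s_pos: "s > 0"
proof (rule ccontr)
  assume "\<not> s > 0"
  then have "P = {}" "Q = {}" using parts by auto
  then have XG: "X = verts G" using verts_eq by simp
  obtain u where u: "u \<in> X" using X_nonempty by blast
  obtain x where x: "eigenfunction G \<mu> x" "\<forall>v\<in>X. x v = (if v = u then 1 else 0)"
    using star_set_eigenfunction[OF fin_digraph star, of "\<lambda>v. if v = u then 1 else 0"] by blast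
  have "(\<Sum>w\<in>nbrs u. x w) = \<mu> * x u"
    using x(1) u XG by (auto simp: eigenfunction_def nbrs_def)
  moreover have "(\<Sum>w\<in>nbrs u. x w) = 0"
    using x(2) XG nbrs_subset[of u] nbrs_irrefl[of u] by (intro sum.neutral) auto
  ultimately show False using x(2) u \<mu>_nonzero by simp
qed

text \<open>Otherwise the function with value \<open>s\<close> on \<open>P\<close> and \<mu> on
  \<open>Q\<close> would be an eigenfunction of \<open>K_{s,s}\<close> for \<mu>.\<close>

lemma \<mu>_not_pm_s: "\<mu>\<^sup>2 - (real s)\<^sup>2 \<noteq> 0"
proof
  assume "\<mu>\<^sup>2 - (real s)\<^sup>2 = 0"
  then have "\<mu> * \<mu> = real s * real s" by (simp add: power2_eq_square)
  define x where "x = (\<lambda>u. if u \<in> P then real s else \<mu>)"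
  let ?H = "induce_subgraph G (verts G - X)"
  have H: "fin_digraph ?H"
    by (auto intro: fin_digraph.intro simp: fin_digraph_axioms_def wellformed_induce_subgraph)
  have "eigenfunction ?H \<mu> x"
    unfolding eigenfunction_def bipartite
  proof
    fix u assume "u \<in> verts ?H"
    then consider "u \<in> P" "u \<notin> Q" | "u \<in> Q" "u \<notin> P" using parts by auto
    then show "(\<Sum>w | (u, w) \<in> P \<times> Q \<union> Q \<times> P. x w) = \<mu> * x u"
    proof cases
      case 1
      then have "{w. (u, w) \<in> P \<times> Q \<union> Q \<times> P} = Q" by auto
      moreover have "(\<Sum>w\<in>Q. x w) = (\<Sum>w\<in>Q. \<mu>)"
        using parts(2) by (intro sum.cong) (auto simp: x_def)
      ultimately show ?thesis using 1 parts by (simp add: x_def)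
    next
      case 2
      then have "{w. (u, w) \<in> P \<times> Q \<union> Q \<times> P} = P" by auto
      moreover have "(\<Sum>w\<in>P. x w) = (\<Sum>w\<in>P. real s)"
        by (intro sum.cong) (auto simp: x_def)
      ultimately show ?thesis using 2 parts \<open>\<mu> * \<mu> = _\<close> by (simp add: x_def)
    qed
  qed
  moreover obtain u where "u \<in> P" using parts(3) s_pos by fastforce
  then have "u \<in> verts ?H \<and> x u \<noteq> 0" using s_pos parts(1) by (auto simp: x_def)
  ultimately have "graph_eigenvalue ?H \<mu>"
    using graph_eigenvalue_iff_eigenfunction[OF H] by blast
  then show False using star by (simp add: star_set_def)
qed

text \<open>
  The eigenfunction that is the indicator of \<open>u\<close> on \<open>X\<close>. On \<open>P \<union> Q\<close> it is
  \<open>(\<mu> I - C)\<inverse> b\<^sub>u\<close>, where \<open>C\<close> is the adjacency matrix of \<open>K\<^bsub>s,s\<^esub>\<close> and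
  \<open>b\<^sub>u\<close> is the indicator of the neighbours of \<open>u\<close>.
\<close>

lemma star_eigenfunction:
  assumes u: "u \<in> X"
  obtains x where "eigenfunction G \<mu> x" "\<And>v. v \<in> X \<Longrightarrow> x v = of_bool (v = u)"
    "\<And>i. i \<in> P \<Longrightarrow> \<mu> * x i = sum x Q + of_bool (i \<in> nbrs u)"
    "\<And>i. i \<in> Q \<Longrightarrow> \<mu> * x i = sum x P + of_bool (i \<in> nbrs u)"
    "\<mu> * sum x P = real s * sum x Q + degP u"
    "\<mu> * sum x Q = real s * sum x P + degQ u"
proof -
  obtain x where x: "eigenfunction G \<mu> x" "\<forall>v\<in>X. x v = of_bool (v = u)"
    using star_set_eigenfunction[OF fin_digraph star, of "\<lambda>v. of_bool (v = u)"] by blast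
  have Xpart: "(\<Sum>w\<in>nbrs i \<inter> X. x w) = of_bool (i \<in> nbrs u)" for i
  proof -
    have "(\<Sum>w\<in>nbrs i \<inter> X. x w) = (\<Sum>w\<in>nbrs i \<inter> X. if w = u then 1 else 0)"
      using x(2) by (intro sum.cong) auto
    also have "\<dots> = of_bool (i \<in> nbrs u)" using u nbrs_sym by simp
    finally show ?thesis .
  qed
  have ef: "sum x (nbrs i) = \<mu> * x i" if "i \<in> verts G" for i
    using x(1) that by (simp add: eigenfunction_def nbrs_def)
  have P: "\<mu> * x i = sum x Q + of_bool (i \<in> nbrs u)" if i: "i \<in> P" for i
  proof -
    have "\<mu> * x i = sum x (Q \<union> (nbrs i \<inter> X))" using ef[of i] i verts_eq nbrs_P[OF i] by simp
    also have "\<dots> = sum x Q + sum x (nbrs i \<inter> X)"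
      using disjoint by (intro sum.union_disjoint) auto
    finally show ?thesis using Xpart by simp
  qed
  have Q: "\<mu> * x i = sum x P + of_bool (i \<in> nbrs u)" if i: "i \<in> Q" for i
  proof -
    have "\<mu> * x i = sum x (P \<union> (nbrs i \<inter> X))" using ef[of i] i verts_eq nbrs_Q[OF i] by simp
    also have "\<dots> = sum x P + sum x (nbrs i \<inter> X)"
      using disjoint by (intro sum.union_disjoint) auto
    finally show ?thesis using Xpart by simp
  qed
  have "\<mu> * sum x P = (\<Sum>i\<in>P. sum x Q + of_bool (i \<in> nbrs u))"
    unfolding sum_distrib_left by (intro sum.cong) (auto simp: P)
  then have sP: "\<mu> * sum x P = real s * sum x Q + degP u"
    by (simp add: sum.distrib parts of_bool_def sum.If_cases degP_def Int_commute)
  have "\<mu> * sum x Q = (\<Sum>i\<in>Q. sum x P + of_bool (i \<in> nbrs u))"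
    unfolding sum_distrib_left by (intro sum.cong) (auto simp: Q)
  then have sQ: "\<mu> * sum x Q = real s * sum x P + degQ u"
    by (simp add: sum.distrib parts of_bool_def sum.If_cases degQ_def Int_commute)
  show thesis using that x P Q sP sQ by blast
qed

text \<open>The eigenvalue equation at \<open>v\<close> for the eigenfunction of \<open>u\<close>,
  with denominators cleared. It is an entry of
  \<open>\<mu> I - A = B^T (\<mu> I - C)^{-1} B\<close>, where \<open>A\<close> is the adjacency
  matrix on \<open>X\<close> and \<open>B\<close> has the columns \<open>b_u\<close>.\<close>

lemma star_equation:
  assumes u: "u \<in> X" and v: "v \<in> X"
  shows "\<mu> * (\<mu>\<^sup>2 - (real s)\<^sup>2) * (\<mu> * of_bool (u = v) - of_bool (v \<in> nbrs u)) =
    (\<mu>\<^sup>2 - (real s)\<^sup>2) * codeg u v + \<mu> * (degP u * degQ v + degQ u * degP v)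
    + s * (degP u * degP v + degQ u * degQ v)"
proof -
  from star_eigenfunction[OF u] obtain x where x: "eigenfunction G \<mu> x"
    "\<And>v. v \<in> X \<Longrightarrow> x v = of_bool (v = u)"
    "\<And>i. i \<in> P \<Longrightarrow> \<mu> * x i = sum x Q + of_bool (i \<in> nbrs u)"
    "\<And>i. i \<in> Q \<Longrightarrow> \<mu> * x i = sum x P + of_bool (i \<in> nbrs u)"
    "\<mu> * sum x P = real s * sum x Q + degP u"
    "\<mu> * sum x Q = real s * sum x P + degQ u"
    by metis
  \<comment> \<open>Each neighbour of \<open>v\<close> in \<open>P\<close> contributes
    \<open>sum x Q\<close>, plus one if it is also a neighbour of \<open>u\<close>.\<close>
  have P: "\<mu> * sum x (nbrs v \<inter> P) = degP v * sum x Q + card (nbrs v \<inter> P \<inter> nbrs u)"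
  proof -
    have "\<mu> * sum x (nbrs v \<inter> P) = (\<Sum>i\<in>nbrs v \<inter> P. sum x Q + of_bool (i \<in> nbrs u))"
      unfolding sum_distrib_left by (intro sum.cong) (auto simp: x)
    then show ?thesis by (simp add: sum.distrib of_bool_def sum.If_cases degP_def)
  qed
  have Q: "\<mu> * sum x (nbrs v \<inter> Q) = degQ v * sum x P + card (nbrs v \<inter> Q \<inter> nbrs u)"
  proof -
    have "\<mu> * sum x (nbrs v \<inter> Q) = (\<Sum>i\<in>nbrs v \<inter> Q. sum x P + of_bool (i \<in> nbrs u))"
      unfolding sum_distrib_left by (intro sum.cong) (auto simp: x)
    then show ?thesis by (simp add: sum.distrib of_bool_def sum.If_cases degQ_def)
  qed
  have "codeg u v = card ((nbrs v \<inter> P \<inter> nbrs u) \<union> (nbrs v \<inter> Q \<inter> nbrs u))"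
    unfolding codeg_def by (rule arg_cong[where f = card]) blast
  also have "\<dots> = card (nbrs v \<inter> P \<inter> nbrs u) + card (nbrs v \<inter> Q \<inter> nbrs u)"
    using parts(2) by (intro card_Un_disjoint) auto
  finally have codeg: "real (codeg u v) = card (nbrs v \<inter> P \<inter> nbrs u) + card (nbrs v \<inter> Q \<inter> nbrs u)"
    by simp
  have "\<mu> * of_bool (u = v) = sum x (nbrs v)"
    using x(1) x(2)[OF v] v X_subset by (auto simp: eigenfunction_def nbrs_def)
  also have "\<dots> = sum x (nbrs v \<inter> X) + (sum x (nbrs v \<inter> P) + sum x (nbrs v \<inter> Q))"
    by (subst nbrs_X[of v], subst sum.union_disjoint)
      (use disjoint parts(2) in \<open>auto intro!: sum.union_disjoint\<close>)
  also have "sum x (nbrs v \<inter> X) = (\<Sum>w\<in>nbrs v \<inter> X. if w = u then 1 else 0)"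
    using x(2) by (intro sum.cong) auto
  also have "\<dots> = of_bool (v \<in> nbrs u)" using u nbrs_sym by simp
  finally have "\<mu> * (\<mu> * of_bool (u = v) - of_bool (v \<in> nbrs u)) =
      \<mu> * sum x (nbrs v \<inter> P) + \<mu> * sum x (nbrs v \<inter> Q)"
    by (simp add: algebra_simps)
  also have "\<dots> = codeg u v + degP v * sum x Q + degQ v * sum x P"
    unfolding P Q codeg by simp
  finally have main: "\<mu> * (\<mu> * of_bool (u = v) - of_bool (v \<in> nbrs u)) =
      codeg u v + degP v * sum x Q + degQ v * sum x P" .
  \<comment> \<open>The sums over \<open>P\<close> and \<open>Q\<close> solve a 2 by 2 linear system
    of determinant \<open>\<mu>\<^sup>2 - (real s)\<^sup>2\<close>; \<open>SP\<close> and
    \<open>SQ\<close> are Cramer's rule.\<close>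
  have SP: "(\<mu>\<^sup>2 - (real s)\<^sup>2) * sum x P = \<mu> * degP u + s * degQ u"
  proof -
    have "\<mu>\<^sup>2 * sum x P = \<mu> * (real s * sum x Q + degP u)"
      using x(5) by (simp add: power2_eq_square mult.assoc)
    also have "\<dots> = s * (\<mu> * sum x Q) + \<mu> * degP u" by (simp add: algebra_simps)
    finally show ?thesis unfolding x(6) by (simp add: algebra_simps power2_eq_square)
  qed
  have SQ: "(\<mu>\<^sup>2 - (real s)\<^sup>2) * sum x Q = \<mu> * degQ u + s * degP u"
  proof -
    have "\<mu>\<^sup>2 * sum x Q = \<mu> * (real s * sum x P + degQ u)"
      using x(6) by (simp add: power2_eq_square mult.assoc)
    also have "\<dots> = s * (\<mu> * sum x P) + \<mu> * degQ u" by (simp add: algebra_simps)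
    finally show ?thesis unfolding x(5) by (simp add: algebra_simps power2_eq_square)
  qed
  have "(\<mu>\<^sup>2 - (real s)\<^sup>2) * (\<mu> * (\<mu> * of_bool (u = v) - of_bool (v \<in> nbrs u))) =
      (\<mu>\<^sup>2 - (real s)\<^sup>2) * codeg u v + degP v * ((\<mu>\<^sup>2 - (real s)\<^sup>2) * sum x Q)
      + degQ v * ((\<mu>\<^sup>2 - (real s)\<^sup>2) * sum x P)"
    unfolding main by (simp only: distrib_left mult_ac)
  then show ?thesis unfolding SP SQ by (simp add: algebra_simps)
qed

lemma codeg_self: "codeg u u = degP u + degQ u"
proof -
  have "nbrs u \<inter> nbrs u \<inter> (P \<union> Q) = (nbrs u \<inter> P) \<union> (nbrs u \<inter> Q)" by blast
  then show ?thesis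
    using parts(2) unfolding codeg_def degP_def degQ_def
    by (simp add: card_Un_disjoint disjoint_iff)
qed

lemma star_equation_diag:
  assumes "u \<in> X"
  shows "\<mu>\<^sup>2 * (\<mu>\<^sup>2 - (real s)\<^sup>2) = (\<mu>\<^sup>2 - (real s)\<^sup>2) * (degP u + degQ u)
    + 2 * \<mu> * degP u * degQ u + s * ((degP u)\<^sup>2 + (degQ u)\<^sup>2)"
  using star_equation[OF assms assms] codeg_self nbrs_irrefl
  by (simp add: power2_eq_square algebra_simps)

section \<open>Double counting, integrality of \<mu> and the bound\<close>

text \<open>The value \<open>x w\<close> is counted once for each neighbour of \<open>w\<close>,
  hence \<open>r\<close> times.\<close>

lemma sum_nbrs_verts: "(\<Sum>u\<in>verts G. sum x (nbrs u)) = r * sum x (verts G)" for x :: "'a \<Rightarrow> real"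
proof -
  have "(\<Sum>u\<in>verts G. sum x (nbrs u)) = (\<Sum>u\<in>verts G. \<Sum>w | w \<in> verts G \<and> w \<in> nbrs u. x w)"
    using nbrs_subset by (intro sum.cong) (auto intro!: arg_cong[where f = "sum x"])
  also have "\<dots> = (\<Sum>w\<in>verts G. \<Sum>u | u \<in> verts G \<and> w \<in> nbrs u. x w)"
    by (rule sum.swap_restrict) auto
  also have "\<dots> = (\<Sum>w\<in>verts G. r * x w)"
  proof (rule sum.cong)
    fix w assume w: "w \<in> verts G"
    have "{u \<in> verts G. w \<in> nbrs u} = nbrs w" using nbrs_subset nbrs_sym by auto
    then show "(\<Sum>u | u \<in> verts G \<and> w \<in> nbrs u. x w) = r * x w" using card_nbrs[OF w] by simp
  qed simp
  finally show ?thesis by (simp add: sum_distrib_left)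
qed

text \<open>Eigenfunctions for \<open>\<mu> \<noteq> r\<close> are orthogonal to the constant functions.\<close>

lemma deg_sum_eq:
  assumes "\<mu> \<noteq> r" "u \<in> X"
  shows "real (degP u + degQ u) = s - \<mu>"
proof -
  from star_eigenfunction[OF assms(2)] obtain x where x: "eigenfunction G \<mu> x"
    "\<And>v. v \<in> X \<Longrightarrow> x v = of_bool (v = u)"
    "\<mu> * sum x P = real s * sum x Q + degP u"
    "\<mu> * sum x Q = real s * sum x P + degQ u"
    by metis
  have "(\<Sum>u\<in>verts G. sum x (nbrs u)) = (\<Sum>u\<in>verts G. \<mu> * x u)"
    using x(1) by (intro sum.cong) (auto simp: eigenfunction_def nbrs_def)
  then have "r * sum x (verts G) = \<mu> * sum x (verts G)"
    unfolding sum_nbrs_verts by (simp add: sum_distrib_left)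
  then have "sum x (verts G) = 0" using assms(1) by simp
  also have "sum x (verts G) = sum x X + (sum x P + sum x Q)"
    unfolding verts_eq Un_assoc using disjoint parts(2)
    by (subst sum.union_disjoint) (auto simp: sum.union_disjoint)
  also have "sum x X = (\<Sum>v\<in>X. if v = u then 1 else 0)"
    using x(2) by (intro sum.cong) auto
  also have "\<dots> = 1" using assms(2) by simp
  finally have "sum x P + sum x Q = - 1" by simp
  \<comment> \<open>With this, adding the equations for the two parts gives
    \<open>- \<mu> = - s + degP u + degQ u\<close>.\<close>
  then have "sum x Q = - 1 - sum x P" by simp
  with x(3,4) show ?thesis by (simp add: algebra_simps)
qed

text \<open>The opposite part supplies \<open>s\<close> of the \<open>r\<close> neighbours. Writing
  a sum instead of \<open>r - s\<close> also yields \<open>s_le_r\<close>.\<close>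

lemma card_nbrs_X:
  assumes "i \<in> P \<union> Q"
  shows "s + card (nbrs i \<inter> X) = r"
proof -
  have "r = card (nbrs i)" using card_nbrs[of i] assms verts_eq by auto
  also have "\<dots> = s + card (nbrs i \<inter> X)"
  proof (cases "i \<in> P")
    case True
    then show ?thesis using disjoint parts by (subst nbrs_P, simp, subst card_Un_disjoint) auto
  next
    case False
    with assms have "i \<in> Q" by simp
    then show ?thesis using disjoint parts by (subst nbrs_Q, simp, subst card_Un_disjoint) auto
  qed
  finally show ?thesis by simp
qed

lemma s_le_r: "s \<le> r"
proof -
  have "P \<noteq> {}" using s_pos parts(3) by auto
  then show ?thesis using card_nbrs_X by force
qed

text \<open>Both sides count the edges between \<open>X\<close> and the star complement, whose 2 s
  vertices each have r - s neighbours in \<open>X\<close>.\<close>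

lemma sum_deg: "(\<Sum>u\<in>X. degP u + degQ u) = 2 * s * (r - s)"
proof -
  have double: "(\<Sum>u\<in>X. card (nbrs u \<inter> Y)) = (\<Sum>i\<in>Y. card (nbrs i \<inter> X))" if "finite Y" for Y
  proof -
    have "(\<Sum>u\<in>X. card (nbrs u \<inter> Y)) = (\<Sum>u\<in>X. \<Sum>i | i \<in> Y \<and> i \<in> nbrs u. 1)"
      by (intro sum.cong) (auto intro!: arg_cong[where f = card])
    also have "\<dots> = (\<Sum>i\<in>Y. \<Sum>u | u \<in> X \<and> i \<in> nbrs u. 1)"
      using that by (intro sum.swap_restrict) auto
    also have "\<dots> = (\<Sum>i\<in>Y. card (nbrs i \<inter> X))"
      using nbrs_sym by (intro sum.cong) (auto intro!: arg_cong[where f = card])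
    finally show ?thesis .
  qed
  have "(\<Sum>u\<in>X. degP u + degQ u) = (\<Sum>i\<in>P. card (nbrs i \<inter> X)) + (\<Sum>i\<in>Q. card (nbrs i \<inter> X))"
    by (simp add: sum.distrib degP_def degQ_def double)
  also have "\<dots> = (\<Sum>i\<in>P. r - s) + (\<Sum>i\<in>Q. r - s)"
    using card_nbrs_X by (intro arg_cong2[where f = "(+)"] sum.cong) force+
  finally show ?thesis using parts by simp
qed

text \<open>Either \<mu> = r, which is at least \<open>s\<close>, or \<open>deg_sum_eq\<close> makes
  \<mu> an integer. The diagonal identity thus becomes a Diophantine equation.\<close>

lemma \<mu>_int:
  assumes "u \<in> X"
  obtains m :: int where "\<mu> = m" "m \<noteq> 0" "m\<^sup>2 \<noteq> (int s)\<^sup>2" "m = int s - int (degP u + degQ u) \<or> int s \<le> m"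
    "m\<^sup>2 * (m\<^sup>2 - (int s)\<^sup>2) = (m\<^sup>2 - (int s)\<^sup>2) * (degP u + degQ u)
      + 2 * m * degP u * degQ u + s * ((int (degP u))\<^sup>2 + (int (degQ u))\<^sup>2)"
proof -
  obtain m :: int where m: "\<mu> = m" "m = int s - int (degP u + degQ u) \<or> int s \<le> m"
  proof (cases "\<mu> = r")
    case True
    then show thesis using that[of "int r"] s_le_r by simp
  next
    case False
    then have "\<mu> = of_int (int s - int (degP u + degQ u))" using deg_sum_eq[OF False assms] by simp
    then show thesis using that by blast
  qed
  have "m\<^sup>2 \<noteq> (int s)\<^sup>2"
    using \<mu>_not_pm_s unfolding m(1) by (metis of_int_of_nat_eq of_int_power right_minus_eq)
  moreover have "real_of_int (m\<^sup>2 * (m\<^sup>2 - (int s)\<^sup>2)) = real_of_int ((m\<^sup>2 - (int s)\<^sup>2) * (degP u + degQ u)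
      + 2 * m * degP u * degQ u + s * ((int (degP u))\<^sup>2 + (int (degQ u))\<^sup>2))"
    using star_equation_diag[OF assms] unfolding m(1) by simp
  then have "m\<^sup>2 * (m\<^sup>2 - (int s)\<^sup>2) = (m\<^sup>2 - (int s)\<^sup>2) * (degP u + degQ u)
      + 2 * m * degP u * degQ u + s * ((int (degP u))\<^sup>2 + (int (degQ u))\<^sup>2)"
    unfolding of_int_eq_iff .
  ultimately show thesis using that m \<mu>_nonzero by auto
qed

lemma deg_ge_2:
  assumes u: "u \<in> X"
  shows "2 \<le> degP u + degQ u"
proof (rule ccontr)
  assume small: "\<not> 2 \<le> degP u + degQ u"
  obtain m :: int where m: "m \<noteq> 0" "m\<^sup>2 \<noteq> (int s)\<^sup>2" "m = int s - int (degP u + degQ u) \<or> int s \<le> m"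
    "m\<^sup>2 * (m\<^sup>2 - (int s)\<^sup>2) = (m\<^sup>2 - (int s)\<^sup>2) * (degP u + degQ u)
      + 2 * m * degP u * degQ u + s * ((int (degP u))\<^sup>2 + (int (degQ u))\<^sup>2)"
    using \<mu>_int[OF u] by metis
  \<comment> \<open>With no neighbours the identity reads
    \<open>m\<^sup>2 * (m\<^sup>2 - s\<^sup>2) = 0\<close>; with one it is the equation of
    \<open>int_star_equation_1_impossible\<close>.\<close>
  consider "degP u = 0" "degQ u = 0" | "degP u = 0" "degQ u = 1" | "degP u = 1" "degQ u = 0"
    using small by linarith
  then show False
  proof cases
    case 1
    then show ?thesis using m by simp
  qed (use m int_star_equation_1_impossible[of "int s" m] s_pos in \<open>simp_all add: algebra_simps\<close>)
qed

lemma card_X_le: "card X \<le> s * (r - s)"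
proof -
  have "2 * card X = (\<Sum>u\<in>X. 2)" by simp
  also have "\<dots> \<le> (\<Sum>u\<in>X. degP u + degQ u)" using deg_ge_2 by (intro sum_mono) auto
  finally show ?thesis using sum_deg by simp
qed

lemma card_X_eq_imp:
  assumes "2 \<le> s" "card X = s * (r - s)" "u \<in> X"
  shows "s = 3 \<and> \<mu> = 1 \<and> degP u = 1 \<and> degQ u = 1"
proof -
  \<comment> \<open>The sums compared in \<open>card_X_le\<close> now agree, so no term can exceed
    its lower bound 2.\<close>
  have "(\<Sum>u\<in>X. 2) = (\<Sum>u\<in>X. degP u + degQ u)" using assms sum_deg by simp
  then have deg: "degP u + degQ u = 2"
    using sum_mono_inv[of "\<lambda>u. 2" X "\<lambda>u. degP u + degQ u" u] deg_ge_2 assms(3) by simp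
  obtain m :: int where m: "\<mu> = m" "m \<noteq> 0" "m\<^sup>2 \<noteq> (int s)\<^sup>2" "m = int s - int (degP u + degQ u) \<or> int s \<le> m"
    "m\<^sup>2 * (m\<^sup>2 - (int s)\<^sup>2) = (m\<^sup>2 - (int s)\<^sup>2) * (degP u + degQ u)
      + 2 * m * degP u * degQ u + s * ((int (degP u))\<^sup>2 + (int (degQ u))\<^sup>2)"
    using \<mu>_int[OF assms(3)] by metis
  have "int s = 3 \<and> m = 1 \<and> degP u = 1 \<and> degQ u = 1"
    using int_star_equation_2[of "int s" m "degP u" "degQ u"] m(2-5) deg assms(1) by simp
  then show ?thesis using m(1) by simp
qed

end

section \<open>The graphs \<open>\<Gamma>(S)\<close>\<close>

text \<open>Without parallel arcs, adjacency determines the arcs: each is sent to the pair of images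
  of its ends. In \<open>with_proj H\<close> an arc is such a pair, with the projections as tail and
  head.\<close>

lemma digraph_iso_with_projI:
  assumes "nomulti_digraph G" "bij_betw f (verts G) (pverts H)" "parcs H \<subseteq> pverts H \<times> pverts H"
    and "\<And>u v. u \<in> verts G \<Longrightarrow> v \<in> verts G \<Longrightarrow> (u, v) \<in> arcs_ends G \<longleftrightarrow> (f u, f v) \<in> parcs H"
  shows "digraph_iso G (with_proj H)"
proof -
  interpret nomulti_digraph G by fact
  let ?h = "\<lparr>iso_verts = f, iso_arcs = (\<lambda>a. (f (tail G a), f (head G a))), iso_head = snd, iso_tail = fst\<rparr>"
  have f: "inj_on f (verts G)" "f ` verts G = pverts H" using assms(2) by (auto simp: bij_betw_def)
  have "digraph_isomorphism ?h"
    using f(1) no_multi_arcs wf_digraph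
    by (auto simp: digraph_isomorphism_def inj_on_def arc_to_ends_def)
  moreover have "(\<lambda>a. (f (tail G a), f (head G a))) ` arcs G = parcs H"
  proof (intro Set.set_eqI iffI)
    fix e assume "e \<in> (\<lambda>a. (f (tail G a), f (head G a))) ` arcs G"
    then obtain a where a: "a \<in> arcs G" "e = (f (tail G a), f (head G a))" by blast
    then have "(tail G a, head G a) \<in> arcs_ends G" by (auto simp: arcs_ends_conv)
    then show "e \<in> parcs H" using assms(4) a by simp
  next
    fix e assume e: "e \<in> parcs H"
    then obtain u v where uv: "u \<in> verts G" "v \<in> verts G" "e = (f u, f v)"
      using assms(3) f(2) by blast
    then have "(u, v) \<in> arcs_ends G" using assms(4) e by blast
    then show "e \<in> (\<lambda>a. (f (tail G a), f (head G a))) ` arcs G"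
      using uv by (auto simp: arcs_ends_conv)
  qed
  then have "with_proj H = app_iso ?h G"
    using f(2) by (intro pre_digraph.equality) auto
  ultimately show ?thesis by (auto simp: digraph_iso_def)
qed

text \<open>The arcs leaving \<open>v\<close> correspond to the pairs with first entry
  \<open>h\<close>, and \<open>snd\<close> turns these into the neighbours of
  \<open>h\<close>.\<close>

lemma digraph_iso_with_projD:
  assumes "digraph_iso G (with_proj H)" "regular_graph G r"
  shows "card (pverts H) = card (verts G)"
    and "h \<in> pverts H \<Longrightarrow> card {w. (h, w) \<in> parcs H} = r"
proof -
  obtain f where f: "pre_digraph.digraph_isomorphism G f" and H: "with_proj H = app_iso f G"
    using assms(1) by (auto simp: digraph_iso_def)
  have verts: "pverts H = iso_verts f ` verts G" and arcs: "parcs H = iso_arcs f ` arcs G"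
    and ends: "iso_tail f = fst" "iso_head f = snd"
    using arg_cong[OF H, of verts] arg_cong[OF H, of arcs] arg_cong[OF H, of tail]
      arg_cong[OF H, of head] by simp_all
  have inj: "inj_on (iso_verts f) (verts G)" "inj_on (iso_arcs f) (arcs G)" and wf: "wf_digraph G"
    and tail: "\<And>a. a \<in> arcs G \<Longrightarrow> fst (iso_arcs f a) = iso_verts f (tail G a)"
    using f ends by (auto simp: pre_digraph.digraph_isomorphism_def)
  show "card (pverts H) = card (verts G)"
    unfolding verts by (rule card_image[OF inj(1)])
  assume "h \<in> pverts H"
  then obtain v where v: "v \<in> verts G" "h = iso_verts f v" unfolding verts by blast
  have "bij_betw snd (iso_arcs f ` out_arcs G v) {w. (h, w) \<in> parcs H}"
  proof -
    have "iso_arcs f ` out_arcs G v = {e \<in> parcs H. fst e = h}"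
      using v inj(1) tail wf_digraph.tail_in_verts[OF wf]
      by (auto simp: arcs out_arcs_def inj_on_def)
    then show ?thesis by (auto simp: bij_betw_def inj_on_def image_iff)
  qed
  then have "card {w. (h, w) \<in> parcs H} = card (iso_arcs f ` out_arcs G v)"
    by (simp add: bij_betw_same_card)
  also have "\<dots> = out_degree G v"
    unfolding out_degree_def using inj(2) by (intro card_image) (auto simp: inj_on_def)
  finally show "card {w. (h, w) \<in> parcs H} = r" using assms(2) v by (simp add: regular_graph_def)
qed

text \<open>One rule for each ordered pair of vertex kinds, so that adjacency can be settled by
  rewriting.\<close>

lemma gamma_edges_iff:
  "(V_vert i, V_vert i') \<in> gamma_edges S \<union> (gamma_edges S)\<inverse> \<longleftrightarrow> False"
  "(W_vert j, W_vert j') \<in> gamma_edges S \<union> (gamma_edges S)\<inverse> \<longleftrightarrow> False"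
  "(V_vert i, W_vert j) \<in> gamma_edges S \<union> (gamma_edges S)\<inverse> \<longleftrightarrow> i \<in> {1..3} \<and> j \<in> {1..3}"
  "(W_vert j, V_vert i) \<in> gamma_edges S \<union> (gamma_edges S)\<inverse> \<longleftrightarrow> i \<in> {1..3} \<and> j \<in> {1..3}"
  "(U_vert k l, V_vert i) \<in> gamma_edges S \<union> (gamma_edges S)\<inverse> \<longleftrightarrow> (k, l) \<in> S \<and> i = k"
  "(V_vert i, U_vert k l) \<in> gamma_edges S \<union> (gamma_edges S)\<inverse> \<longleftrightarrow> (k, l) \<in> S \<and> i = k"
  "(U_vert k l, W_vert j) \<in> gamma_edges S \<union> (gamma_edges S)\<inverse> \<longleftrightarrow> (k, l) \<in> S \<and> j = l"
  "(W_vert j, U_vert k l) \<in> gamma_edges S \<union> (gamma_edges S)\<inverse> \<longleftrightarrow> (k, l) \<in> S \<and> j = l"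
  "(U_vert k l, U_vert k' l') \<in> gamma_edges S \<union> (gamma_edges S)\<inverse> \<longleftrightarrow>
    (k, l) \<in> S \<and> (k', l') \<in> S \<and> k \<noteq> k' \<and> l \<noteq> l'"
  unfolding gamma_edges_def by auto

text \<open>The degree is read off at \<open>V_vert 1\<close>, whose neighbours are the three
  \<open>W_vert j\<close> and the \<open>U_vert 1 j\<close> from row 1 of \<open>S\<close>.\<close>

lemma Gamma_graph_iso_invariants:
  assumes "digraph_iso G (Gamma_graph S)" "regular_graph G r" "S \<subseteq> {1..3} \<times> {1..3}"
  shows "card (verts G) = 6 + card S" and "r = 3 + card {j. (1, j) \<in> S}"
proof -
  let ?H = "\<lparr>pverts = V_vert ` {1..3} \<union> W_vert ` {1..3} \<union> {U_vert i j | i j. (i, j) \<in> S},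
      parcs = gamma_edges S \<union> (gamma_edges S)\<inverse>\<rparr>"
  have iso: "digraph_iso G (with_proj ?H)" using assms(1) by (simp add: Gamma_graph_def)
  have fin: "finite S" using assms(3) by (rule finite_subset) simp
  have "pverts ?H = (V_vert ` {1..3} \<union> W_vert ` {1..3}) \<union> case_prod U_vert ` S" by auto
  also have "card \<dots> = card (V_vert ` {1..3} \<union> W_vert ` {1..3}) + card (case_prod U_vert ` S)"
    using fin by (intro card_Un_disjoint) auto
  also have "card (V_vert ` {1..3} \<union> W_vert ` {1..3}) = card (V_vert ` {1..3}) + card (W_vert ` {1..3})"
    by (intro card_Un_disjoint) auto
  also have "\<dots> = 6" by (subst (1 2) card_image) (auto simp: inj_on_def)
  also have "card (case_prod U_vert ` S) = card S" by (intro card_image) (auto simp: inj_on_def)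
  finally show "card (verts G) = 6 + card S"
    using digraph_iso_with_projD(1)[OF iso assms(2)] by simp
  have "{w. (V_vert 1, w) \<in> gamma_edges S \<union> (gamma_edges S)\<inverse>} =
      W_vert ` {1..3} \<union> U_vert 1 ` {j. (1, j) \<in> S}" (is "?N = _")
  proof (intro Set.set_eqI)
    fix w show "w \<in> ?N \<longleftrightarrow> w \<in> W_vert ` {1..3} \<union> U_vert 1 ` {j. (1, j) \<in> S}"
      by (cases w) (simp_all only: mem_Collect_eq gamma_edges_iff, auto)
  qed
  moreover have "finite {j. (1, j) \<in> S}"
    using fin by (rule finite_surj[of _ _ snd]) force
  moreover have "card (W_vert ` {1..3}) = 3" "card (U_vert 1 ` {j. (1, j) \<in> S}) = card {j. (1, j) \<in> S}"
    by (subst card_image, auto simp: inj_on_def)+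
  moreover have "W_vert ` {1..3} \<inter> U_vert 1 ` {j. (1, j) \<in> S} = {}" by auto
  ultimately have "card ?N = 3 + card {j. (1, j) \<in> S}"
    by (simp only: card_Un_disjoint finite_imageI finite_atLeastAtMost)
  moreover have "card ?N = r"
    using digraph_iso_with_projD(2)[OF iso assms(2), of "V_vert 1"] by simp
  ultimately show "r = 3 + card {j. (1, j) \<in> S}" by simp
qed

section \<open>Normal forms of 3 by 3 matrices with constant row and column sums\<close>

text \<open>\<open>R\<close> is the graph of a bijection. Label \<open>P\<close> arbitrarily and
  give each element of \<open>Q\<close> the label of its partner.\<close>

lemma ex_bij_betw_image_diagonal:
  assumes fin: "finite P" "finite C" and card: "card P = card C"
    and R: "R \<subseteq> P \<times> Q" "\<And>i. i \<in> P \<Longrightarrow> \<exists>!j. (i, j) \<in> R" "\<And>j. j \<in> Q \<Longrightarrow> \<exists>!i. (i, j) \<in> R"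
  shows "\<exists>\<alpha> \<beta>. bij_betw \<alpha> P C \<and> bij_betw \<beta> Q C \<and> map_prod \<alpha> \<beta> ` R = (\<lambda>a. (a, a)) ` C"
proof -
  obtain \<alpha> where \<alpha>: "bij_betw \<alpha> P C" using finite_same_card_bij[OF fin card] by blast
  define g where "g j = (THE i. (i, j) \<in> R)" for j
  have g: "(g j, j) \<in> R" if "j \<in> Q" for j
    unfolding g_def by (rule theI'[OF R(3)[OF that]])
  have g_eq: "g j = i" if "(i, j) \<in> R" for i j
    using that g[of j] R(1) R(3)[of j] by blast
  have "bij_betw g Q P"
    unfolding bij_betw_def
  proof
    show "inj_on g Q"
    proof (rule inj_onI)
      fix j j' assume "j \<in> Q" "j' \<in> Q" "g j = g j'"
      with g[of j] g[of j'] R(1) R(2)[of "g j"] show "j = j'" by auto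
    qed
    show "g ` Q = P"
    proof
      show "g ` Q \<subseteq> P" using g R(1) by blast
      show "P \<subseteq> g ` Q"
      proof
        fix i assume "i \<in> P"
        then obtain j where "(i, j) \<in> R" using R(2) by blast
        then show "i \<in> g ` Q" using g_eq R(1) by blast
      qed
    qed
  qed
  then have "bij_betw (\<alpha> \<circ> g) Q C" using \<alpha> by (rule bij_betw_trans)
  moreover have "map_prod \<alpha> (\<alpha> \<circ> g) ` R = (\<lambda>a. (a, a)) ` C"
  proof -
    have "map_prod \<alpha> (\<alpha> \<circ> g) ` R = (\<lambda>e. (\<alpha> (fst e), \<alpha> (fst e))) ` R"
      using g_eq by (intro image_cong) auto
    also have "\<dots> = (\<lambda>a. (a, a)) ` \<alpha> ` fst ` R" by (simp add: image_image)
    also have "fst ` R = P" using R(1,2) by force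
    finally show ?thesis using \<alpha> by (simp add: bij_betw_def comp_def)
  qed
  ultimately show ?thesis using \<alpha> by blast
qed

text \<open>For t = 1 the set \<open>T\<close> is a permutation matrix, for t = 2 the complement of
  one, and for t = 3 everything.\<close>

lemma biregular_3x3_labelling:
  assumes P: "finite P" "card P = 3" and Q: "finite Q" "card Q = 3" and T: "T \<subseteq> P \<times> Q"
    and rows: "\<And>i. i \<in> P \<Longrightarrow> card {j. (i, j) \<in> T} = t"
    and cols: "\<And>j. j \<in> Q \<Longrightarrow> card {i. (i, j) \<in> T} = t"
    and "t > 0"
  obtains \<alpha> \<beta> where "bij_betw \<alpha> P {1..3::nat}" "bij_betw \<beta> Q {1..3::nat}"
    "map_prod \<alpha> \<beta> ` T \<in> {{(1, 1), (2, 2), (3, 3)}, {(i, j). i \<in> {1..3} \<and> j \<in> {1..3} \<and> i \<noteq> j}, {1..3} \<times> {1..3}}"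
proof -
  have diag: "(\<lambda>a. (a, a)) ` {1..3::nat} = {(1, 1), (2, 2), (3, 3)}" by force
  have cardC: "card P = card {1..3::nat}" using P by simp
  have rowsub: "{j. (i, j) \<in> T} \<subseteq> Q" and colsub: "{i. (i, j) \<in> T} \<subseteq> P" for i j using T by auto
  obtain i where i: "i \<in> P" using P(2) by fastforce
  have "t \<le> 3" using card_mono[OF Q(1) rowsub[of i]] rows[OF i] Q(2) by simp
  then consider "t = 1" | "t = 2" | "t = 3" using \<open>t > 0\<close> by linarith
  then show thesis
  proof cases
    case 1
    have "\<exists>!j. (i, j) \<in> T" if "i \<in> P" for i
      using rows[OF that] 1 by (auto simp: card_1_singleton_iff set_eq_iff)
    moreover have "\<exists>!i. (i, j) \<in> T" if "j \<in> Q" for j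
      using cols[OF that] 1 by (auto simp: card_1_singleton_iff set_eq_iff)
    ultimately obtain \<alpha> \<beta> where "bij_betw \<alpha> P {1..3::nat}" "bij_betw \<beta> Q {1..3::nat}"
      "map_prod \<alpha> \<beta> ` T = (\<lambda>a. (a, a)) ` {1..3}"
      using ex_bij_betw_image_diagonal[OF P(1) finite_atLeastAtMost cardC T] by blast
    then show ?thesis using that diag by simp
  next
    case 2
    let ?R = "P \<times> Q - T"
    have "\<exists>!j. (i, j) \<in> ?R" if "i \<in> P" for i
    proof -
      have "card (Q - {j. (i, j) \<in> T}) = 1"
        using rows[OF that] 2 Q rowsub[of i] by (simp add: card_Diff_subset finite_subset)
      then obtain c where "Q - {j. (i, j) \<in> T} = {c}" by (auto simp: card_1_singleton_iff)
      then show ?thesis using that by (intro ex1I[of _ c]) blast+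
    qed
    moreover have "\<exists>!i. (i, j) \<in> ?R" if "j \<in> Q" for j
    proof -
      have "card (P - {i. (i, j) \<in> T}) = 1"
        using cols[OF that] 2 P colsub[of j] by (simp add: card_Diff_subset finite_subset)
      then obtain c where "P - {i. (i, j) \<in> T} = {c}" by (auto simp: card_1_singleton_iff)
      then show ?thesis using that by (intro ex1I[of _ c]) blast+
    qed
    ultimately obtain \<alpha> \<beta> where ab: "bij_betw \<alpha> P {1..3::nat}" "bij_betw \<beta> Q {1..3::nat}"
      "map_prod \<alpha> \<beta> ` ?R = (\<lambda>a. (a, a)) ` {1..3}"
      using ex_bij_betw_image_diagonal[OF P(1) finite_atLeastAtMost cardC, of ?R Q] by blast
    \<comment> \<open>Injectivity lets the image commute with the complement, so the diagonal turns
      into the cells off it.\<close>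
    have inj: "inj_on (map_prod \<alpha> \<beta>) (P \<times> Q)"
      using ab by (intro map_prod_inj_on) (auto simp: bij_betw_def)
    have "P \<times> Q - ?R = T" using T by blast
    moreover have "map_prod \<alpha> \<beta> ` (P \<times> Q - ?R) = map_prod \<alpha> \<beta> ` (P \<times> Q) - map_prod \<alpha> \<beta> ` ?R"
      by (rule inj_on_image_set_diff[OF inj]) auto
    ultimately have "map_prod \<alpha> \<beta> ` T = map_prod \<alpha> \<beta> ` (P \<times> Q) - map_prod \<alpha> \<beta> ` ?R" by simp
    also have "map_prod \<alpha> \<beta> ` (P \<times> Q) = {1..3} \<times> {1..3}"
      using ab by (simp add: map_prod_surj_on bij_betw_def)
    also have "\<dots> - map_prod \<alpha> \<beta> ` ?R = {(i, j). i \<in> {1..3} \<and> j \<in> {1..3} \<and> i \<noteq> j}"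
      unfolding ab(3) by auto
    finally show ?thesis using that[OF ab(1,2)] by blast
  next
    case 3
    obtain \<alpha> \<beta> where ab: "bij_betw \<alpha> P {1..3::nat}" "bij_betw \<beta> Q {1..3::nat}"
      using finite_same_card_bij[of P "{1..3::nat}"] finite_same_card_bij[of Q "{1..3::nat}"] P Q by auto
    have "{j. (i, j) \<in> T} = Q" if "i \<in> P" for i
      using card_subset_eq[OF Q(1) rowsub[of i]] rows[OF that] 3 Q by simp
    then have "T = P \<times> Q" using T by auto
    then have "map_prod \<alpha> \<beta> ` T = {1..3} \<times> {1..3}"
      using ab by (simp add: map_prod_surj_on bij_betw_def)
    then show ?thesis using that[OF ab] by blast
  qed
qed

section \<open>The case of equality\<close>

context Kss_star_complement
begin

lemma card_X_eq_imp_iso: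
  assumes s: "2 \<le> s" and card: "card X = s * (r - s)"
  shows "\<mu> = 1 \<and> (digraph_iso G G1 \<or> digraph_iso G G2 \<or> digraph_iso G G3)"
proof -
  have s3: "s = 3" and mu: "\<mu> = 1" using card_X_eq_imp[OF s card] X_nonempty by blast+
  define p q where "p u = the_elem (nbrs u \<inter> P)" and "q u = the_elem (nbrs u \<inter> Q)" for u
  have p: "nbrs u \<inter> P = {p u}" and q: "nbrs u \<inter> Q = {q u}" if "u \<in> X" for u
    using card_X_eq_imp[OF s card that]
    by (auto simp: degP_def degQ_def p_def q_def card_1_singleton_iff)
  have pP: "p u \<in> P" and qQ: "q u \<in> Q" if "u \<in> X" for u using p[OF that] q[OF that] by blast+
  \<comment> \<open>For s = 3, \<mu> = 1 and all degrees 1, this is \<open>star_equation\<close>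
    divided by 8.\<close>
  have codeg: "codeg u v + of_bool (v \<in> nbrs u) = (1 :: nat)" if "u \<in> X" "v \<in> X" "u \<noteq> v" for u v
  proof -
    have "real (codeg u v + of_bool (v \<in> nbrs u)) = 1"
      using star_equation[OF that(1,2)] card_X_eq_imp[OF s card that(1)]
        card_X_eq_imp[OF s card that(2)] that(3) by (simp split: split_of_bool_asm)
    then show ?thesis by (metis of_nat_1 of_nat_eq_iff)
  qed
  have codeg_pq: "codeg u v = of_bool (p u = p v) + of_bool (q u = q v)" if "u \<in> X" "v \<in> X" for u v
  proof -
    have "nbrs u \<inter> nbrs v \<inter> (P \<union> Q) = (nbrs u \<inter> P) \<inter> (nbrs v \<inter> P) \<union> (nbrs u \<inter> Q) \<inter> (nbrs v \<inter> Q)"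
      by blast
    also have "\<dots> = ({p u} \<inter> {p v}) \<union> ({q u} \<inter> {q v})" using p q that by simp
    moreover have "p u \<noteq> q u" using pP[OF that(1)] qQ[OF that(1)] parts(2) by auto
    ultimately show ?thesis by (auto simp: codeg_def)
  qed
  \<comment> \<open>Equal pairs would give two common neighbours in \<open>K_{3,3}\<close>, but
    \<open>codeg\<close> allows at most one.\<close>
  have inj_pq: "u = v" if "u \<in> X" "v \<in> X" "p u = p v" "q u = q v" for u v
    using codeg[of u v] codeg_pq[of u v] that by auto
  have adj: "v \<in> nbrs u \<longleftrightarrow> p u \<noteq> p v \<and> q u \<noteq> q v" if "u \<in> X" "v \<in> X" for u v
  proof (cases "u = v")
    case True
    then show ?thesis using nbrs_irrefl by simp
  next
    case False
    then have "\<not> (p u = p v \<and> q u = q v)" using inj_pq that by blast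
    moreover have "of_bool (p u = p v) + of_bool (q u = q v) + of_bool (v \<in> nbrs u) = (1 :: nat)"
      using codeg[OF that False] codeg_pq[OF that] by simp
    ultimately show ?thesis
      by (cases "p u = p v"; cases "q u = q v"; cases "v \<in> nbrs u") simp_all
  qed
  have nbr_p: "i \<in> nbrs u \<longleftrightarrow> i = p u" if "u \<in> X" "i \<in> P" for u i
    using p[OF that(1)] that(2) by blast
  have nbr_q: "j \<in> nbrs u \<longleftrightarrow> j = q u" if "u \<in> X" "j \<in> Q" for u j
    using q[OF that(1)] that(2) by blast
  define T where "T = (\<lambda>u. (p u, q u)) ` X"
  have T: "T \<subseteq> P \<times> Q" using pP qQ by (auto simp: T_def)
  have rows: "card {j. (i, j) \<in> T} = r - s" if i: "i \<in> P" for i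
  proof -
    \<comment> \<open>The vertices of \<open>X\<close> in row \<open>i\<close> are the neighbours of
      \<open>i\<close>, and \<open>q\<close> tells them apart.\<close>
    have "bij_betw q (nbrs i \<inter> X) {j. (i, j) \<in> T}"
      unfolding bij_betw_def inj_on_def T_def
      using nbrs_sym[of _ i] nbr_p[OF _ i] inj_pq by auto
    then show ?thesis using card_nbrs_X[of i] i by (auto dest: bij_betw_same_card)
  qed
  have cols: "card {i. (i, j) \<in> T} = r - s" if j: "j \<in> Q" for j
  proof -
    have "bij_betw p (nbrs j \<inter> X) {i. (i, j) \<in> T}"
      unfolding bij_betw_def inj_on_def T_def
      using nbrs_sym[of _ j] nbr_q[OF _ j] inj_pq by auto
    then show ?thesis using card_nbrs_X[of j] j by (auto dest: bij_betw_same_card)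
  qed
  have "card X > 0" using X_nonempty by (simp add: card_gt_0_iff)
  then have "r - s > 0" using card by simp
  have card3: "card P = 3" "card Q = 3" using parts s3 by simp_all
  obtain \<alpha> \<beta> where ab: "bij_betw \<alpha> P {1..3::nat}" "bij_betw \<beta> Q {1..3::nat}"
    and labelled: "map_prod \<alpha> \<beta> ` T \<in> {{(1, 1), (2, 2), (3, 3)},
      {(i, j). i \<in> {1..3} \<and> j \<in> {1..3} \<and> i \<noteq> j}, {1..3} \<times> {1..3}}"
    by (rule biregular_3x3_labelling[OF finite_parts(2) card3(1) finite_parts(3) card3(2) T rows cols \<open>r - s > 0\<close>])
  define S where "S = map_prod \<alpha> \<beta> ` T"
  have S: "S = (\<lambda>u. (\<alpha> (p u), \<beta> (q u))) ` X" by (simp add: S_def T_def image_image)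
  have \<alpha>: "\<alpha> i = \<alpha> i' \<longleftrightarrow> i = i'" "\<alpha> i \<in> {1..3}" if "i \<in> P" "i' \<in> P" for i i'
    using ab(1) that by (auto simp: bij_betw_def inj_on_def)
  have \<beta>: "\<beta> j = \<beta> j' \<longleftrightarrow> j = j'" "\<beta> j \<in> {1..3}" if "j \<in> Q" "j' \<in> Q" for j j'
    using ab(2) that by (auto simp: bij_betw_def inj_on_def)
  \<comment> \<open>The last branch is meant for \<open>X\<close>, where a vertex is named by its
    cell.\<close>
  define f where "f x = (if x \<in> P then V_vert (\<alpha> x) else if x \<in> Q then W_vert (\<beta> x)
      else U_vert (\<alpha> (p x)) (\<beta> (q x)))" for x
  have fP: "f x = V_vert (\<alpha> x)" if "x \<in> P" for x using that by (simp add: f_def)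
  have fQ: "f x = W_vert (\<beta> x)" if "x \<in> Q" for x using that parts(2) by (auto simp: f_def)
  have fX: "f x = U_vert (\<alpha> (p x)) (\<beta> (q x))" if "x \<in> X" for x
    using that disjoint by (auto simp: f_def)
  let ?V = "V_vert ` {1..3} \<union> W_vert ` {1..3} \<union> {U_vert i j | i j. (i, j) \<in> S}"
  let ?E = "gamma_edges S \<union> (gamma_edges S)\<inverse>"
  have "digraph_iso G (with_proj \<lparr>pverts = ?V, parcs = ?E\<rparr>)"
  proof (rule digraph_iso_with_projI)
    show "nomulti_digraph G" by (rule nomulti_digraph)
    have "inj_on f (verts G)"
    proof (rule inj_onI)
      fix x y assume xy: "x \<in> verts G" "y \<in> verts G" and eq: "f x = f y"
      from xy consider "x \<in> P" "y \<in> P" | "x \<in> P" "y \<in> Q" | "x \<in> P" "y \<in> X"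
        | "x \<in> Q" "y \<in> P" | "x \<in> Q" "y \<in> Q" | "x \<in> Q" "y \<in> X"
        | "x \<in> X" "y \<in> P" | "x \<in> X" "y \<in> Q" | "x \<in> X" "y \<in> X"
        using verts_eq by blast
      then show "x = y" using eq
        by cases (simp_all add: fP fQ fX \<alpha> \<beta> pP qQ inj_pq)
    qed
    moreover have "f ` verts G = ?V"
    proof -
      have "f ` P = V_vert ` \<alpha> ` P" "f ` Q = W_vert ` \<beta> ` Q"
        unfolding image_image using fP fQ by (auto intro: image_cong)
      moreover have "f ` X = {U_vert i j | i j. (i, j) \<in> S}"
        unfolding S using fX by (auto simp: image_iff)
      ultimately show ?thesis
        using ab unfolding verts_eq image_Un bij_betw_def by (simp add: Un_ac)
    qed
    ultimately show "bij_betw f (verts G) (pverts \<lparr>pverts = ?V, parcs = ?E\<rparr>)"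
      by (simp add: bij_betw_def)
    have "S \<subseteq> {1..3} \<times> {1..3}" using labelled unfolding S_def[symmetric] by auto
    then have "gamma_edges S \<subseteq> ?V \<times> ?V" by (auto simp: gamma_edges_def)
    then show "parcs \<lparr>pverts = ?V, parcs = ?E\<rparr> \<subseteq> pverts \<lparr>pverts = ?V, parcs = ?E\<rparr> \<times> pverts \<lparr>pverts = ?V, parcs = ?E\<rparr>"
      unfolding pair_pre_digraph.simps by blast
    fix x y assume xy: "x \<in> verts G" "y \<in> verts G"
    have inS: "(\<alpha> (p u), \<beta> (q u)) \<in> S" if "u \<in> X" for u using that S by blast
    from xy consider "x \<in> P" "y \<in> P" | "x \<in> P" "y \<in> Q" | "x \<in> P" "y \<in> X"
      | "x \<in> Q" "y \<in> P" | "x \<in> Q" "y \<in> Q" | "x \<in> Q" "y \<in> X"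
      | "x \<in> X" "y \<in> P" | "x \<in> X" "y \<in> Q" | "x \<in> X" "y \<in> X"
      using verts_eq by blast
    then have "y \<in> nbrs x \<longleftrightarrow> (f x, f y) \<in> ?E"
    proof cases
      case 1
      then show ?thesis using ends_in_H[of x y] parts(2) by (simp only: fP gamma_edges_iff) blast
    next
      case 2
      then show ?thesis using ends_in_H[of x y] \<alpha>(2) \<beta>(2) by (simp only: fP fQ gamma_edges_iff) blast
    next
      case 3
      then show ?thesis
        using nbrs_sym[of y x] nbr_p[of y x] \<alpha>(1)[of x "p y"] pP inS
        by (simp only: fP fX gamma_edges_iff) blast
    next
      case 4
      then show ?thesis using ends_in_H[of x y] \<alpha>(2) \<beta>(2) by (simp only: fP fQ gamma_edges_iff) blast
    next
      case 5
      then show ?thesis using ends_in_H[of x y] parts(2) by (simp only: fQ gamma_edges_iff) blast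
    next
      case 6
      then show ?thesis
        using nbrs_sym[of y x] nbr_q[of y x] \<beta>(1)[of x "q y"] qQ inS
        by (simp only: fQ fX gamma_edges_iff) blast
    next
      case 7
      then show ?thesis
        using nbr_p[of x y] \<alpha>(1)[of y "p x"] pP inS
        by (simp only: fP fX gamma_edges_iff) blast
    next
      case 8
      then show ?thesis
        using nbr_q[of x y] \<beta>(1)[of y "q x"] qQ inS
        by (simp only: fQ fX gamma_edges_iff) blast
    next
      case 9
      then show ?thesis
        using adj[of x y] \<alpha>(1)[of "p x" "p y"] \<beta>(1)[of "q x" "q y"] pP qQ inS
        by (simp only: fX gamma_edges_iff) blast
    qed
    then show "(x, y) \<in> arcs_ends G \<longleftrightarrow> (f x, f y) \<in> parcs \<lparr>pverts = ?V, parcs = ?E\<rparr>"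
      by (simp add: nbrs_def)
  qed
  then have "digraph_iso G (Gamma_graph S)" by (simp add: Gamma_graph_def)
  then show ?thesis
    using mu labelled unfolding G1_def G2_def G3_def S_def[symmetric] by auto
qed

text \<open>The value s = 3 is not given here and must be recovered. Order and degree leave finitely
  many \<open>s\<close>, and the edge count excludes the others.\<close>

lemma iso_imp_card_X_eq:
  assumes mu: "\<mu> = 1" and iso: "digraph_iso G G1 \<or> digraph_iso G G2 \<or> digraph_iso G G3"
  shows "card X = s * (r - s)"
proof -
  have inv: "card X + 2 * s = 6 + card S \<and> r = 3 + card {j. (1, j) \<in> S}"
    if "digraph_iso G (Gamma_graph S)" "S \<subseteq> {1..3} \<times> {1..3}" for S
    using Gamma_graph_iso_invariants[OF that(1) regular that(2)] card_verts by simp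
  have "card X + 2 * s = 9 \<and> r = 4 \<or> card X + 2 * s = 12 \<and> r = 5 \<or> card X + 2 * s = 15 \<and> r = 6"
    using iso
  proof (elim disjE)
    assume "digraph_iso G G1"
    moreover have "{j. (1, j) \<in> {(1, 1), (2, 2), (3 :: nat, 3 :: nat)}} = {1}" by auto
    ultimately show ?thesis using inv[of "{(1, 1), (2, 2), (3, 3)}"] by (simp add: G1_def)
  next
    assume "digraph_iso G G2"
    moreover have "{(i, j). i \<in> {1..3} \<and> j \<in> {1..3} \<and> i \<noteq> j} =
        {(1, 2), (1, 3), (2, 1), (2, 3), (3, 1), (3 :: nat, 2 :: nat)}" by auto
    moreover have "{j. (1, j) \<in> {(1, 2), (1, 3), (2, 1), (2, 3), (3, 1), (3 :: nat, 2 :: nat)}} = {2, 3}"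
      by auto
    ultimately show ?thesis
      using inv[of "{(1, 2), (1, 3), (2, 1), (2, 3), (3, 1), (3, 2)}"] by (simp add: G2_def)
  next
    assume "digraph_iso G G3"
    moreover have "{j. (1, j) \<in> {1..3 :: nat} \<times> {1..3 :: nat}} = {1..3}" by auto
    ultimately show ?thesis
      using inv[of "{1..3} \<times> {1..3}"] by (simp add: G3_def card_cartesian_product)
  qed
  \<comment> \<open>The orders 9, 12, 15 and degrees 4, 5, 6 share the relation n = 3 (r -
    1).\<close>
  then have r: "r \<in> {4, 5, 6}" and n: "card X + 2 * s = 3 * (r - 1)" by auto
  \<comment> \<open>Since \<mu> = 1 differs from \<open>r\<close>, \<open>deg_sum_eq\<close>
    applies.\<close>
  have "real (\<Sum>u\<in>X. degP u + degQ u) = (\<Sum>u\<in>X. real s - 1)"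
    unfolding of_nat_sum using deg_sum_eq mu r by (intro sum.cong) auto
  then have "real (2 * s * (r - s)) = real (card X * (s - 1))"
    using sum_deg s_pos by (simp add: of_nat_diff)
  then have e: "2 * s * (r - s) = card X * (s - 1)" unfolding of_nat_eq_iff .
  \<comment> \<open>Among these values, \<open>n\<close> and \<open>e\<close> hold together only for
    s = 3.\<close>
  have "s \<in> {1, 2, 3, 4, 5, 6}" using s_le_r s_pos r by auto
  with r e n s_le_r show ?thesis by auto
qed

end

text \<open>Integers keep the difference of \<open>r\<close> and \<open>s\<close> untruncated. The
  two bounds differ by 2 s, just as \<open>n\<close> and \<open>k\<close> do, so each form follows
  from the other.\<close>

theorem theorem5p3:
  fixes G :: "('a, 'b) pre_digraph" and n r s k :: nat and \<mu> :: real
  assumes "graph G"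
    and "regular_graph G r"
    and "card (verts G) = n"
    and "\<mu> \<notin> {-1, 0}"
    and "eigenvalue_multiplicity G \<mu> = k"
    and "has_Kss_star_complement G s \<mu>"
  shows "int k \<le> int s * (int r - int s) \<and>
    int n \<le> int s * (int r - int s + 2) \<and>
    (int k \<le> int s * (int r - int s) \<longleftrightarrow> int n \<le> int s * (int r - int s + 2)) \<and>
    (2 \<le> s \<longrightarrow>
      (int k = int s * (int r - int s) \<longleftrightarrow>
        \<mu> = 1 \<and> (digraph_iso G G1 \<or> digraph_iso G G2 \<or> digraph_iso G G3)) \<and>
      (int n = int s * (int r - int s + 2) \<longleftrightarrow>
        \<mu> = 1 \<and> (digraph_iso G G1 \<or> digraph_iso G G2 \<or> digraph_iso G G3)))"
proof -
  obtain X where star: "star_set G \<mu> X"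
    and bip: "complete_bipartite_digraph s s (induce_subgraph G (verts G - X))"
    using assms(6) by (auto simp: has_Kss_star_complement_def)
  obtain P Q where PQ: "verts G - X = P \<union> Q" "P \<inter> Q = {}" "card P = s" "card Q = s"
    "arcs_ends (induce_subgraph G (verts G - X)) = P \<times> Q \<union> Q \<times> P"
    using bip by (auto simp: complete_bipartite_digraph_def)
  interpret Kss_star_complement G r s \<mu> X P Q
    using assms(1,2,4) star PQ by (auto simp: Kss_star_complement_def Kss_star_complement_axioms_def)
  have k: "k = card X" using star assms(5) by (simp add: star_set_def)
  have n: "n = k + 2 * s" using card_verts assms(3) k by simp
  have rs: "int (s * (r - s)) = int s * (int r - int s)" using s_le_r by (simp add: of_nat_diff)
  have le: "int k \<le> int s * (int r - int s)"
    unfolding rs[symmetric] k using card_X_le by (simp only: of_nat_le_iff)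
  have "int k = int s * (int r - int s) \<longleftrightarrow>
      \<mu> = 1 \<and> (digraph_iso G G1 \<or> digraph_iso G G2 \<or> digraph_iso G G3)" if "2 \<le> s"
    unfolding rs[symmetric] k of_nat_eq_iff using card_X_eq_imp_iso[OF that] iso_imp_card_X_eq by blast
  moreover have "int n = int k + 2 * int s" using n by simp
  moreover have "int s * (int r - int s + 2) = int s * (int r - int s) + 2 * int s"
    by (simp add: algebra_simps)
  ultimately show ?thesis using le by simp
qed

end
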